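(* For the random walk $(Z_n)$ on the free product of groups $\Gamma=\Gamma_1\ast\dots\ast\Gamma_r$ described in the context, $\mathbb{P}_e$-almost surely $\ell(Z_n)/n$ converges as $n\to\infty$ to the constant $$\ell=\sum_{i\in\mathcal{I}}\alpha_i\,\frac{1-\xi_i}{\xi_i}\,\bigl(1-(1-\xi_i)\,G_i(\xi_i)\bigr).$$
   Context: Let $\mathcal{I}=\{1,\dots,r\}$ with $r\ge2$, and let $\Gamma_i$, $i\in\mathcal{I}$, be non-trivial finitely generated groups with identities $e_i$ (with pairwise trivial intersections; they may be isomorphic). The case $r=2=|\Gamma_1|=|\Gamma_2|$ is excluded. Put $\Gamma_i^\times=\Gamma_i\setminus\{e_i\}$. The free product $\Gamma=\Gamma_1\ast\dots\ast\Gamma_r$ is the set of finite words $x_1\dots x_m$ with letters (blocks) in $\bigcup_i\Gamma_i^\times$, no two consecutive letters from the same $\Gamma_i$, including the empty word $e$; the group operation is concatenation followed by the possible cancellations and contractions, and each $\Gamma_i$ is regarded as a subgroup of $\Gamma$ (so $e_i$ is identified with $e$). The block length is $\ell(x_1\dots x_m)=m$, $\ell(e)=0$. For each $i\in\mathcal{I}$ let $\mu_i$ be a probability measure on $\Gamma_i^\times$ such that the random walk on $\Gamma_i$ with transition probabilities $p_i(x,y)=\mu_i(x^{-1}y)$ is irreducible. Let $p_i^{(n)}$ be its $n$-step probabilities. Fix $\alpha_1,\dots,\alpha_r>0$ with $\sum_i\alpha_i=1$. The random walk $(Z_n)_{n\ge0}$ on $\Gamma$ has transition probabilities $p(x,xg)=\alpha_i\mu_i(g)$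 for $x\in\Gamma$, $g\in\Gamma_i^\times$, $i\in\mathcal{I}$, and $p(x,y)=0$ otherwise. $\mathbb{P}_e$ is its law started at $e$. Let $S_e=\min\{k>0: Z_k=e\}$, $\bar H_i(z)=\sum_{n\ge2}\mathbb{P}_e[S_e=n, Z_1\notin\Gamma_i]z^n$, $\xi_i(z)=\dfrac{\alpha_i z}{1-\bar H_i(z)}$, $\xi_i=\xi_i(1)$ (one has $\xi_i<1$), and $G_i(z)=G_i(e_i,e_i|z)=\sum_{n\ge0}p_i^{(n)}(e_i,e_i)z^n$. *)

theory Defs
  imports "HOL-Algebra.Generated_Groups" "HOL-Probability.Probability"
begin

section \<open>Free products of groups\<close>

text \<open>
  The factors \<open>G i\<close> may share elements of their common carrier type, so a block of a word
  is tagged with the index of its factor. This makes the sets of blocks of different factors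
  disjoint.
\<close>

definition blocks :: "(nat \<Rightarrow> ('a, 'b) monoid_scheme) \<Rightarrow> nat set \<Rightarrow> (nat \<times> 'a) set" where
  "blocks G I = (SIGMA i:I. carrier (G i) - {\<one>\<^bsub>G i\<^esub>})"

fun mult_block :: "(nat \<Rightarrow> ('a, 'b) monoid_scheme) \<Rightarrow> nat \<times> 'a \<Rightarrow> (nat \<times> 'a) list \<Rightarrow> (nat \<times> 'a) list"
where
  "mult_block G a [] = [a]"
| "mult_block G (i, g) ((j, h) # w) =
     (if i = j
      then (if g \<otimes>\<^bsub>G i\<^esub> h = \<one>\<^bsub>G i\<^esub> then w else (i, g \<otimes>\<^bsub>G i\<^esub> h) # w)
      else (i, g) # (j, h) # w)"

definition free_product :: "(nat \<Rightarrow> ('a, 'b) monoid_scheme) \<Rightarrow> nat set \<Rightarrow> (nat \<times> 'a) list monoid" where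
  "free_product G I =
     \<lparr>carrier = {w. set w \<subseteq> blocks G I \<and> successively (\<lambda>a b. fst a \<noteq> fst b) w},
      monoid.mult = (\<lambda>u v. foldr (mult_block G) u v),
      one = []\<rparr>"

definition embed :: "(nat \<Rightarrow> ('a, 'b) monoid_scheme) \<Rightarrow> nat \<Rightarrow> 'a \<Rightarrow> (nat \<times> 'a) list" where
  "embed G i g = (if g = \<one>\<^bsub>G i\<^esub> then [] else [(i, g)])"

abbreviation block_length :: "(nat \<times> 'a) list \<Rightarrow> nat" where
  "block_length \<equiv> length"


section \<open>Random walks\<close>

primrec nstep_prob :: "'s set \<Rightarrow> ('s \<Rightarrow> 's \<Rightarrow> real) \<Rightarrow> nat \<Rightarrow> 's \<Rightarrow> 's \<Rightarrow> real" where
  "nstep_prob S p 0 x y = of_bool (x = y)"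
| "nstep_prob S p (Suc n) x y = (\<Sum>\<^sub>\<infinity>w\<in>S. p x w * nstep_prob S p n w y)"

definition irreducible_chain :: "'s set \<Rightarrow> ('s \<Rightarrow> 's \<Rightarrow> real) \<Rightarrow> bool" where
  "irreducible_chain S p \<longleftrightarrow> (\<forall>x\<in>S. \<forall>y\<in>S. \<exists>n. nstep_prob S p n x y > 0)"

definition green :: "'s set \<Rightarrow> ('s \<Rightarrow> 's \<Rightarrow> real) \<Rightarrow> 's \<Rightarrow> 's \<Rightarrow> real \<Rightarrow> real" where
  "green S p x y z = (\<Sum>n. nstep_prob S p n x y * z ^ n)"

definition group_trans :: "('a, 'b) monoid_scheme \<Rightarrow> 'a pmf \<Rightarrow> 'a \<Rightarrow> 'a \<Rightarrow> real" where
  "group_trans H \<nu> x y = pmf \<nu> (inv\<^bsub>H\<^esub> x \<otimes>\<^bsub>H\<^esub> y)"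

text \<open>
  The increment \<open>inv x \<otimes> y\<close> is the one-block word of \<open>g\<close> exactly if
  \<open>y = x \<otimes> embed G i g\<close>; see lemmas \<open>free_trans_block\<close> and \<open>free_trans_other\<close> below.
\<close>

definition free_trans ::
  "(nat \<Rightarrow> ('a, 'b) monoid_scheme) \<Rightarrow> nat set \<Rightarrow> (nat \<Rightarrow> real) \<Rightarrow> (nat \<Rightarrow> 'a pmf) \<Rightarrow>
   (nat \<times> 'a) list \<Rightarrow> (nat \<times> 'a) list \<Rightarrow> real" where
  "free_trans G I \<alpha> \<mu> x y =
     (case inv\<^bsub>free_product G I\<^esub> x \<otimes>\<^bsub>free_product G I\<^esub> y of
        [(i, g)] \<Rightarrow> \<alpha> i * pmf (\<mu> i) g
      | _ \<Rightarrow> 0)"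

definition markov_chain_from ::
  "'w measure \<Rightarrow> 's set \<Rightarrow> ('s \<Rightarrow> 's \<Rightarrow> real) \<Rightarrow> 's \<Rightarrow> (nat \<Rightarrow> 'w \<Rightarrow> 's) \<Rightarrow> bool" where
  "markov_chain_from M S p s Z \<longleftrightarrow>
     prob_space M \<and>
     (\<forall>n. Z n \<in> M \<rightarrow>\<^sub>M count_space S) \<and>
     (\<forall>n. \<forall>x. (\<forall>k\<le>n. x k \<in> S) \<longrightarrow>
        measure M {\<omega> \<in> space M. \<forall>k\<le>n. Z k \<omega> = x k} =
        of_bool (x 0 = s) * (\<Prod>k<n. p (x k) (x (Suc k))))"

text \<open>The return time is \<open>\<infinity>\<close> if the path never returns to \<open>s\<close>.\<close>

definition return_time :: "(nat \<Rightarrow> 'w \<Rightarrow> 's) \<Rightarrow> 's \<Rightarrow> 'w \<Rightarrow> enat" where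
  "return_time Z s \<omega> = (INF k\<in>{k. 0 < k \<and> Z k \<omega> = s}. enat k)"

definition Hbar ::
  "'w measure \<Rightarrow> (nat \<Rightarrow> 'w \<Rightarrow> (nat \<times> 'a) list) \<Rightarrow> (nat \<Rightarrow> ('a, 'b) monoid_scheme) \<Rightarrow>
   nat \<Rightarrow> real \<Rightarrow> real" where
  "Hbar M Z G i z =
     (\<Sum>\<^sub>\<infinity>n\<in>{2..}. measure M {\<omega> \<in> space M. return_time Z [] \<omega> = enat n \<and>
                                        Z 1 \<omega> \<notin> embed G i ` carrier (G i)} * z ^ n)"

definition xi ::
  "'w measure \<Rightarrow> (nat \<Rightarrow> 'w \<Rightarrow> (nat \<times> 'a) list) \<Rightarrow> (nat \<Rightarrow> ('a, 'b) monoid_scheme) \<Rightarrow>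
   (nat \<Rightarrow> real) \<Rightarrow> nat \<Rightarrow> real \<Rightarrow> real" where
  "xi M Z G \<alpha> i z = \<alpha> i * z / (1 - Hbar M Z G i z)"


section \<open>The free product is a group\<close>

lemma free_product_simps:
  "carrier (free_product G I) = {w. set w \<subseteq> blocks G I \<and> successively (\<lambda>a b. fst a \<noteq> fst b) w}"
  "u \<otimes>\<^bsub>free_product G I\<^esub> v = foldr (mult_block G) u v"
  "\<one>\<^bsub>free_product G I\<^esub> = []"
  by (simp_all add: free_product_def)

context
  fixes G :: "nat \<Rightarrow> ('a, 'b) monoid_scheme" and I :: "nat set"
  assumes grp: "\<And>i. i \<in> I \<Longrightarrow> group (G i)"
begin

private abbreviation (input) "W \<equiv> carrier (free_product G I)"

lemma mult_block_closed:
  assumes "a \<in> blocks G I" "w \<in> W"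
  shows "mult_block G a w \<in> W"
proof (cases w)
  case Nil
  then show ?thesis using assms by (simp add: free_product_simps)
next
  case (Cons b v)
  obtain i g j h where ab: "a = (i, g)" "b = (j, h)" by fastforce
  interpret Gi: group "G i" using grp assms ab by (auto simp: blocks_def)
  have "x \<otimes>\<^bsub>G i\<^esub> y \<in> carrier (G i)" if "x \<in> carrier (G i)" "y \<in> carrier (G i)" for x y
    using that by simp
  then show ?thesis using assms
    by (cases v; cases "j = i") (auto simp: Cons ab free_product_simps blocks_def)
qed

lemma mult_block_twice:
  assumes "(i, g) \<in> blocks G I" "(i, h) \<in> blocks G I" "w \<in> W"
  shows "mult_block G (i, g) (mult_block G (i, h) w) =
    (if g \<otimes>\<^bsub>G i\<^esub> h = \<one>\<^bsub>G i\<^esub> then w else mult_block G (i, g \<otimes>\<^bsub>G i\<^esub> h) w)"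
proof -
  interpret Gi: group "G i" using grp assms by (auto simp: blocks_def)
  have gh: "g \<in> carrier (G i)" "h \<in> carrier (G i)" "g \<noteq> \<one>\<^bsub>G i\<^esub>" "h \<noteq> \<one>\<^bsub>G i\<^esub>"
    using assms by (auto simp: blocks_def)
  show ?thesis
  proof (cases w)
    case Nil
    then show ?thesis by simp
  next
    case (Cons b v)
    obtain j k where b: "b = (j, k)" by fastforce
    show ?thesis
    proof (cases "i = j")
      case False
      then show ?thesis by (simp add: Cons b)
    next
      case True
      have k: "k \<in> carrier (G i)" "k \<noteq> \<one>\<^bsub>G i\<^esub>"
        using assms True by (auto simp: Cons b free_product_simps blocks_def)
      have v: "v = [] \<or> fst (hd v) \<noteq> i"
        using assms True by (cases v) (auto simp: Cons b free_product_simps)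
      have vg: "mult_block G (i, x) v = (i, x) # v" for x
        using v by (cases v) auto
      have assoc: "g \<otimes>\<^bsub>G i\<^esub> (h \<otimes>\<^bsub>G i\<^esub> k) = (g \<otimes>\<^bsub>G i\<^esub> h) \<otimes>\<^bsub>G i\<^esub> k"
        using gh k by (simp add: Gi.m_assoc)
      have 1: "(g \<otimes>\<^bsub>G i\<^esub> h) \<otimes>\<^bsub>G i\<^esub> k = g" if "h \<otimes>\<^bsub>G i\<^esub> k = \<one>\<^bsub>G i\<^esub>"
        using that assoc gh by simp
      have 2: "(g \<otimes>\<^bsub>G i\<^esub> h) \<otimes>\<^bsub>G i\<^esub> k = k" if "g \<otimes>\<^bsub>G i\<^esub> h = \<one>\<^bsub>G i\<^esub>"
        using that k by simp
      have b': "b = (i, k)" using b True by simp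
      show ?thesis
        using gh k 1 2 by (auto simp: Cons b' vg assoc)
    qed
  qed
qed

lemma free_product_mult_closed:
  assumes "u \<in> W" "v \<in> W"
  shows "foldr (mult_block G) u v \<in> W"
proof -
  have "set u \<subseteq> blocks G I" using assms by (simp add: free_product_simps)
  then show ?thesis by (induction u) (use assms in \<open>auto intro: mult_block_closed\<close>)
qed

lemma mult_block_assoc:
  assumes "a \<in> blocks G I" "v \<in> W" "w \<in> W"
  shows "foldr (mult_block G) (mult_block G a v) w = mult_block G a (foldr (mult_block G) v w)"
proof (cases v)
  case Nil
  then show ?thesis by simp
next
  case (Cons b v')
  obtain i g j h where ab: "a = (i, g)" "b = (j, h)" by fastforce
  have "v' \<in> W" using assms by (cases v') (auto simp: Cons free_product_simps)
  then have "foldr (mult_block G) v' w \<in> W"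
    using assms free_product_mult_closed by blast
  moreover have "b \<in> blocks G I" using assms by (simp add: Cons free_product_simps)
  ultimately show ?thesis
    using assms by (auto simp: Cons ab mult_block_twice)
qed

lemma free_product_assoc:
  assumes "u \<in> W" "v \<in> W" "w \<in> W"
  shows "foldr (mult_block G) (foldr (mult_block G) u v) w =
    foldr (mult_block G) u (foldr (mult_block G) v w)"
proof -
  have "set u \<subseteq> blocks G I" using assms by (simp add: free_product_simps)
  moreover have "foldr (mult_block G) u v \<in> W" if "set u \<subseteq> blocks G I" for u
    using that by (induction u) (use assms in \<open>auto intro: mult_block_closed\<close>)
  ultimately show ?thesis
    by (induction u) (use assms in \<open>auto simp: mult_block_assoc\<close>)
qed

lemma free_product_linv:
  assumes "w \<in> W"
  shows "\<exists>u\<in>W. foldr (mult_block G) u w = []"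
  using assms
proof (induction w)
  case Nil
  then show ?case by (auto intro: bexI[of _ "[]"])
next
  case (Cons a w)
  obtain i g where a: "a = (i, g)" by fastforce
  have w: "w \<in> W" using Cons.prems by (cases w) (auto simp: free_product_simps)
  then obtain u where u: "u \<in> W" "foldr (mult_block G) u w = []" using Cons.IH by blast
  have g: "i \<in> I" "g \<in> carrier (G i)" "g \<noteq> \<one>\<^bsub>G i\<^esub>"
    using Cons.prems by (auto simp: a free_product_simps blocks_def)
  then interpret Gi: group "G i" using grp by blast
  have v: "[(i, inv\<^bsub>G i\<^esub> g)] \<in> W"
    using g by (auto simp: free_product_simps blocks_def)
  have "foldr (mult_block G) (foldr (mult_block G) u [(i, inv\<^bsub>G i\<^esub> g)]) (a # w) = []"
    using free_product_assoc[OF u(1) v Cons.prems] u(2) g by (simp add: a)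
  then show ?case using free_product_mult_closed[OF u(1) v] by blast
qed

lemma group_free_product: "group (free_product G I)"
proof (rule groupI)
  show "\<one>\<^bsub>free_product G I\<^esub> \<in> W" by (simp add: free_product_simps)
qed (use free_product_mult_closed free_product_assoc free_product_linv
     in \<open>auto simp: free_product_simps(2,3)\<close>)

lemma free_trans_block:
  assumes "x \<in> W" "i \<in> I" "g \<in> carrier (G i)" "g \<noteq> \<one>\<^bsub>G i\<^esub>"
  shows "free_trans G I \<alpha> \<mu> x (x \<otimes>\<^bsub>free_product G I\<^esub> embed G i g) = \<alpha> i * pmf (\<mu> i) g"
proof -
  interpret F: group "free_product G I" by (rule group_free_product)
  have "[(i, g)] \<in> W" using assms by (simp add: free_product_simps blocks_def)
  then have "inv\<^bsub>free_product G I\<^esub> x \<otimes>\<^bsub>free_product G I\<^esub> (x \<otimes>\<^bsub>free_product G I\<^esub> [(i, g)]) = [(i, g)]"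
    using assms(1) by (simp add: F.m_assoc[symmetric])
  then show ?thesis using assms by (simp add: free_trans_def embed_def)
qed

lemma free_trans_other:
  assumes "x \<in> W" "y \<in> W"
    and "\<And>i g. i \<in> I \<Longrightarrow> g \<in> carrier (G i) - {\<one>\<^bsub>G i\<^esub>} \<Longrightarrow> y \<noteq> x \<otimes>\<^bsub>free_product G I\<^esub> embed G i g"
  shows "free_trans G I \<alpha> \<mu> x y = 0"
proof -
  interpret F: group "free_product G I" by (rule group_free_product)
  let ?d = "inv\<^bsub>free_product G I\<^esub> x \<otimes>\<^bsub>free_product G I\<^esub> y"
  have d: "?d \<in> W" using assms by simp
  have "x \<otimes>\<^bsub>free_product G I\<^esub> ?d = y" using assms(1,2) by (simp add: F.m_assoc[symmetric])
  then have "?d \<noteq> [(i, g)]" for i g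
    using assms(3)[of i g] d by (auto simp: embed_def free_product_simps(1) blocks_def)
  then show ?thesis by (auto simp: free_trans_def split: list.split)
qed

end

end

theory Submission
  imports Defs
begin

text \<open>
  Write \<open>X\<^sub>1, X\<^sub>2, \<dots>\<close> for the independent one-block increments of the walk, and \<open>off i\<close> for the
  set of words that do not begin with a block of the factor \<open>G i\<close>. Three facts give the theorem.

  \<^bold>\<open>The mean.\<close> Multiplying a word \<open>y\<close> on the left by a block \<open>g\<close> of \<open>G i\<close> lengthens it by one if
  \<open>y\<close> is in \<open>off i\<close>, shortens it by one if \<open>g y\<close> is, and otherwise leaves its length alone. As
  \<open>Z\<^sub>n\<^sub>+\<^sub>1\<close> has the law of \<open>X\<^sub>1 Z\<^sub>n\<close> with independent factors, the increment of \<open>E |Z\<^sub>n|\<close> is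
  \<open>\<Sum>i. \<alpha> i * (P (Z\<^sub>n \<in> off i) - P (g Z\<^sub>n \<in> off i))\<close> with \<open>g\<close> drawn from \<open>\<mu> i\<close> (\<open>mean_Suc\<close>).
  The generating functions of these probabilities are explicit. A walk that starts in a coset
  \<open>x (off i)\<close> can leave it only from \<open>x\<close> itself, by a step in \<open>G i\<close>; before such a step it makes
  excursions from \<open>x\<close> whose generating function is \<open>ret_gf i\<close>. So each step in \<open>G i\<close> costs a
  factor \<open>\<xi> i z\<close> (\<open>caloric_off_gf\<close>), and the projection of the walk to \<open>G i\<close> is the walk of \<open>\<mu> i\<close>
  killed with weight \<open>\<xi> i z\<close>: its Green function appears (\<open>p_off_gf\<close>). Letting \<open>z\<close> tend to 1, the
  Abel means of \<open>E |Z\<^sub>n| / n\<close> converge to \<open>speed\<close> (\<open>mean_gf_tendsto\<close>). Since \<open>E |Z\<^sub>n|\<close> is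
  subadditive, \<open>speed\<close> is then the infimum of \<open>E |Z\<^sub>m| / m\<close> over \<open>m > 0\<close> (\<open>speed_le_mean\<close>,
  \<open>mean_close_to_speed\<close>).

  \<^bold>\<open>Uniformity in the starting point.\<close> From any word \<open>x\<close>, the expected gain of length in \<open>m\<close>
  steps is at most \<open>E |Z\<^sub>m|\<close>. If all \<open>\<xi> i 1\<close> are below 1, it is also at least \<open>E |Z\<^sub>m| - C\<close> with a
  constant \<open>C\<close> that depends on neither \<open>x\<close> nor \<open>m\<close>: cancelling \<open>c\<close> blocks of \<open>x\<close> forces \<open>Z\<^sub>m\<close> to
  begin with \<open>c\<close> prescribed blocks, an event of probability at most \<open>\<kappa> ^ c\<close> for the largest value
  \<open>\<kappa>\<close> of the \<open>\<xi> i 1\<close> (\<open>prob_prefix_le\<close>, \<open>mean_lower\<close>). If some \<open>\<xi> i 1\<close> equals 1, then all do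
  (\<open>xi_dichotomy\<close>); the speed is then 0 and the lower bound is trivial.

  \<^bold>\<open>Concentration.\<close> If a function of the word changes by at most one in each step and its
  expected gain in \<open>m\<close> steps is at most \<open>b\<close> from every starting point, then iterating a bound on
  its exponential moments over blocks of \<open>m\<close> steps shows that it exceeds \<open>c n\<close> at time \<open>n\<close> with
  exponentially small probability, for every \<open>c > b / m\<close> (\<open>exponential_tail\<close>). Applied to the
  length and to its negative, with \<open>m\<close> large, and combined with the Borel-Cantelli lemma, this
  gives almost sure convergence (\<open>AE_speed\<close>). Only the one-dimensional laws of the walk enter, so
  it remains to compute these, and the law of the first excursion, from the finite-dimensional
  distributions of the given Markov chain (\<open>chain_law\<close>, \<open>Hbar_eq\<close>).
\<close>

section \<open>Bounded expectations under discrete distributions\<close>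

abbreviation expect :: "'a pmf \<Rightarrow> ('a \<Rightarrow> real) \<Rightarrow> real" where
  "expect p f \<equiv> measure_pmf.expectation p f"

lemma integrable_pmf_bounded:
  fixes f :: "'a \<Rightarrow> real"
  assumes "\<And>x. x \<in> set_pmf p \<Longrightarrow> \<bar>f x\<bar> \<le> c"
  shows "integrable (measure_pmf p) f"
  by (rule measure_pmf.integrable_const_bound[where B = c])
     (use assms in \<open>auto simp: AE_measure_pmf_iff\<close>)

lemma expect_cong:
  assumes "\<And>x. x \<in> set_pmf p \<Longrightarrow> f x = g x"
  shows "expect p f = expect p g"
  by (intro integral_cong_AE) (use assms in \<open>auto simp: AE_measure_pmf_iff\<close>)

lemma expect_mono:
  assumes "\<And>x. x \<in> set_pmf p \<Longrightarrow> f x \<le> g x"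
    and "\<And>x. x \<in> set_pmf p \<Longrightarrow> \<bar>f x\<bar> \<le> c" "\<And>x. x \<in> set_pmf p \<Longrightarrow> \<bar>g x\<bar> \<le> d"
  shows "expect p f \<le> expect p g"
  by (intro integral_mono_AE integrable_pmf_bounded[where c = c] integrable_pmf_bounded[where c = d])
     (use assms in \<open>auto simp: AE_measure_pmf_iff\<close>)

lemma expect_le:
  assumes "\<And>x. x \<in> set_pmf p \<Longrightarrow> 0 \<le> f x" "\<And>x. x \<in> set_pmf p \<Longrightarrow> f x \<le> c"
  shows "expect p f \<le> c"
proof -
  have "expect p f \<le> expect p (\<lambda>_. c)"
    by (rule expect_mono[where c = c and d = "\<bar>c\<bar>"]) (use assms in fastforce)+
  then show ?thesis by simp
qed

lemma expect_abs_le: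
  assumes "\<And>x. x \<in> set_pmf p \<Longrightarrow> \<bar>f x\<bar> \<le> c"
  shows "\<bar>expect p f\<bar> \<le> c"
proof -
  have c: "\<bar>f x\<bar> \<le> \<bar>c\<bar>" if "x \<in> set_pmf p" for x using assms[OF that] by simp
  have "expect p f \<le> expect p (\<lambda>_. c)"
    by (rule expect_mono[where c = "\<bar>c\<bar>" and d = "\<bar>c\<bar>"]) (use assms c in fastforce)+
  moreover have "expect p (\<lambda>_. -c) \<le> expect p f"
    by (rule expect_mono[where c = "\<bar>c\<bar>" and d = "\<bar>c\<bar>"]) (use assms c in fastforce)+
  ultimately show ?thesis by simp
qed

lemma expect_nonneg:
  assumes "\<And>x. x \<in> set_pmf p \<Longrightarrow> 0 \<le> f x"
  shows "0 \<le> expect p f"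
  by (rule integral_nonneg_AE) (use assms in \<open>auto simp: AE_measure_pmf_iff\<close>)

lemma expect_add:
  assumes "\<And>x. x \<in> set_pmf p \<Longrightarrow> \<bar>f x\<bar> \<le> c" "\<And>x. x \<in> set_pmf p \<Longrightarrow> \<bar>g x\<bar> \<le> d"
  shows "expect p (\<lambda>x. f x + g x) = expect p f + expect p g"
  using assms by (intro Bochner_Integration.integral_add integrable_pmf_bounded) auto

lemma expect_diff:
  assumes "\<And>x. x \<in> set_pmf p \<Longrightarrow> \<bar>f x\<bar> \<le> c" "\<And>x. x \<in> set_pmf p \<Longrightarrow> \<bar>g x\<bar> \<le> d"
  shows "expect p (\<lambda>x. f x - g x) = expect p f - expect p g"
  using assms by (intro Bochner_Integration.integral_diff integrable_pmf_bounded) auto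

lemma expect_sum:
  assumes "\<And>k x. k \<in> A \<Longrightarrow> x \<in> set_pmf p \<Longrightarrow> \<bar>f k x\<bar> \<le> c"
  shows "expect p (\<lambda>x. \<Sum>k\<in>A. f k x) = (\<Sum>k\<in>A. expect p (f k))"
  using assms by (intro Bochner_Integration.integral_sum integrable_pmf_bounded) auto

lemma expect_bind_pmf:
  fixes h :: "'b \<Rightarrow> real"
  assumes "\<And>x y. x \<in> set_pmf p \<Longrightarrow> y \<in> set_pmf (f x) \<Longrightarrow> \<bar>h y\<bar> \<le> c"
  shows "expect (bind_pmf p f) h = expect p (\<lambda>x. expect (f x) h)"
proof -
  let ?h = "\<lambda>y. h y + c"
  have h0: "0 \<le> ?h y" "\<bar>?h y\<bar> \<le> 2 * c" if "x \<in> set_pmf p" "y \<in> set_pmf (f x)" for x y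
    using assms[OF that] by auto
  have in0: "integrable (measure_pmf (f x)) h" if "x \<in> set_pmf p" for x
    by (rule integrable_pmf_bounded) (rule assms[OF that])
  have in1: "integrable (measure_pmf (f x)) ?h" if "x \<in> set_pmf p" for x
    using in0[OF that] by simp
  have ib0: "integrable (bind_pmf p f) h"
    by (rule integrable_pmf_bounded[where c = c]) (use assms in auto)
  then have ib: "integrable (bind_pmf p f) ?h" by simp
  have i2: "integrable p (\<lambda>x. expect (f x) ?h)"
    by (rule integrable_pmf_bounded[where c = "2 * c"], rule expect_abs_le) (use h0 in auto)
  have i3: "integrable p (\<lambda>x. expect (f x) h)"
    by (rule integrable_pmf_bounded[where c = c], rule expect_abs_le) (use assms in auto)
  have "ennreal (expect (bind_pmf p f) ?h) = (\<integral>\<^sup>+y. ?h y \<partial>bind_pmf p f)"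
    by (rule nn_integral_eq_integral[symmetric, OF ib]) (use h0 in \<open>auto simp: AE_measure_pmf_iff\<close>)
  also have "\<dots> = (\<integral>\<^sup>+x. \<integral>\<^sup>+y. ?h y \<partial>f x \<partial>p)" by simp
  also have "\<dots> = (\<integral>\<^sup>+x. ennreal (expect (f x) ?h) \<partial>p)"
    by (intro nn_integral_cong_AE, simp only: AE_measure_pmf_iff, intro ballI nn_integral_eq_integral in1)
       (use h0 in \<open>auto simp: AE_measure_pmf_iff\<close>)
  also have "\<dots> = ennreal (expect p (\<lambda>x. expect (f x) ?h))"
    by (rule nn_integral_eq_integral[OF i2])
       (use h0 in \<open>auto simp: AE_measure_pmf_iff intro!: expect_nonneg\<close>)
  finally have "expect (bind_pmf p f) ?h = expect p (\<lambda>x. expect (f x) ?h)"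
    by (subst (asm) ennreal_inj) (use h0 in \<open>auto intro!: expect_nonneg\<close>)
  also have "\<dots> = expect p (\<lambda>x. expect (f x) h + c)"
    by (rule expect_cong) (simp add: in0)
  finally show ?thesis using ib0 i3 by simp
qed

lemma prob_bind_pmf:
  "measure_pmf.prob (bind_pmf p f) A = expect p (\<lambda>x. measure_pmf.prob (f x) A)"
proof -
  have "expect (bind_pmf p f) (indicator A) = expect p (\<lambda>x. expect (f x) (indicator A))"
    by (rule expect_bind_pmf[where c = 1]) (simp add: indicator_def)
  then show ?thesis by simp
qed

lemma suminf_expect:
  assumes q: "\<And>n x. x \<in> set_pmf p \<Longrightarrow> \<bar>q n x\<bar> \<le> c" and z: "0 \<le> z" "z < 1"
  shows "(\<Sum>n. expect p (q n) * z ^ n) = expect p (\<lambda>x. \<Sum>n. q n x * z ^ n)"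
    and "summable (\<lambda>n. expect p (q n) * z ^ n)"
    and "x \<in> set_pmf p \<Longrightarrow> summable (\<lambda>n. q n x * z ^ n)"
proof -
  have sg: "summable (\<lambda>n. c * z ^ n)" using z by (intro summable_mult summable_geometric) simp
  have b: "\<bar>q n x * z ^ n\<bar> \<le> c * z ^ n" if "x \<in> set_pmf p" for n x
    using q[OF that] z by (auto simp: abs_mult intro!: mult_right_mono)
  have i: "integrable p (\<lambda>x. q n x * z ^ n)" for n
    by (rule integrable_pmf_bounded[OF b])
  have s: "summable (\<lambda>n. \<bar>q n x * z ^ n\<bar>)" if "x \<in> set_pmf p" for x
    by (rule summable_comparison_test[OF _ sg]) (use b[OF that] in auto)
  have s2: "summable (\<lambda>n. expect p (\<lambda>x. \<bar>q n x * z ^ n\<bar>))"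
  proof (rule summable_comparison_test[OF _ sg], intro exI[of _ 0] allI impI)
    show "norm (expect p (\<lambda>x. \<bar>q n x * z ^ n\<bar>)) \<le> c * z ^ n" for n
      unfolding real_norm_def by (rule expect_abs_le) (simp only: abs_abs b)
  qed
  have "(\<Sum>n. expect p (\<lambda>x. q n x * z ^ n)) = expect p (\<lambda>x. \<Sum>n. q n x * z ^ n)"
    by (rule integral_suminf[symmetric, OF i]) (use s s2 in \<open>auto simp: AE_measure_pmf_iff\<close>)
  then show "(\<Sum>n. expect p (q n) * z ^ n) = expect p (\<lambda>x. \<Sum>n. q n x * z ^ n)" by simp
  show "x \<in> set_pmf p \<Longrightarrow> summable (\<lambda>n. q n x * z ^ n)"
    by (rule summable_rabs_cancel[OF s])
  show "summable (\<lambda>n. expect p (q n) * z ^ n)"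
  proof (rule summable_comparison_test[OF _ sg], intro exI[of _ 0] allI impI)
    show "norm (expect p (q n) * z ^ n) \<le> c * z ^ n" for n
      using expect_abs_le[of p "q n" c, OF q] z by (simp add: abs_mult mult_right_mono)
  qed
qed

lemma exp_le_quadratic:
  fixes u :: real
  assumes "\<bar>u\<bar> \<le> 1"
  shows "exp u \<le> 1 + u + u\<^sup>2"
proof (cases "0 \<le> u")
  case True
  then show ?thesis using exp_bound[of u] assms by simp
next
  case False
  have "exp u = 1 / exp (- u)" by (simp add: exp_minus field_simps)
  also have "\<dots> \<le> 1 / (1 - u)"
    using exp_ge_add_one_self[of "- u"] False by (intro divide_left_mono mult_pos_pos) auto
  also have "\<dots> \<le> 1 + u + u\<^sup>2"
  proof -
    have "u ^ 3 \<le> 0" using False by (simp add: power_le_zero_eq)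
    then have "1 \<le> (1 + u + u\<^sup>2) * (1 - u)" by (simp add: algebra_simps power2_eq_square power3_eq_cube)
    then show ?thesis using False by (simp add: pos_divide_le_eq)
  qed
  finally show ?thesis .
qed

text \<open>Close the generators and their inverses under products in countably many rounds.\<close>
lemma countable_generate:
  assumes "countable S"
  shows "countable (generate H S)"
proof -
  define C where "C = rec_nat (insert \<one>\<^bsub>H\<^esub> (S \<union> m_inv H ` S))
    (\<lambda>_ A. A \<union> (\<lambda>(x, y). x \<otimes>\<^bsub>H\<^esub> y) ` (A \<times> A))"
  have C0: "C 0 = insert \<one>\<^bsub>H\<^esub> (S \<union> m_inv H ` S)"
    and CS: "C (Suc n) = C n \<union> (\<lambda>(x, y). x \<otimes>\<^bsub>H\<^esub> y) ` (C n \<times> C n)" for n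
    by (simp_all add: C_def)
  have "countable (C n)" for n
    by (induction n) (use assms in \<open>auto simp: C0 CS\<close>)
  then have "countable (\<Union>n. C n)" by simp
  moreover have mono: "C m \<subseteq> C n" if "m \<le> n" for m n
    by (rule lift_Suc_mono_le[OF _ that]) (simp add: CS)
  have "x \<in> (\<Union>n. C n)" if "x \<in> generate H S" for x
    using that
  proof (induction rule: generate.induct)
    case (eng h1 h2)
    then obtain m n where "h1 \<in> C m" "h2 \<in> C n" by blast
    then have "h1 \<in> C (max m n)" "h2 \<in> C (max m n)"
      using mono[of m "max m n"] mono[of n "max m n"] by auto
    then have "h1 \<otimes>\<^bsub>H\<^esub> h2 \<in> C (Suc (max m n))" by (auto simp: CS)
    then show ?case by blast
  qed (auto intro!: exI[of _ 0] simp: C0)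
  ultimately show ?thesis by (meson countable_subset subsetI)
qed

lemma return_time_eq:
  assumes "0 < n"
  shows "return_time Z s \<omega> = enat n \<longleftrightarrow> Z n \<omega> = s \<and> (\<forall>k. 0 < k \<and> k < n \<longrightarrow> Z k \<omega> \<noteq> s)"
proof
  assume r: "return_time Z s \<omega> = enat n"
  let ?A = "{k. 0 < k \<and> Z k \<omega> = s}"
  have lower: "enat n \<le> enat k" if "k \<in> ?A" for k
    using r INF_lower[OF that, of enat] by (simp add: return_time_def)
  have "?A \<noteq> {}"
  proof
    assume e: "?A = {}"
    have "return_time Z s \<omega> = \<infinity>"
      unfolding return_time_def by (simp only: e image_empty Inf_empty top_enat_def)
    then show False using r by simp
  qed
  then have "(LEAST k. k \<in> ?A) \<in> ?A" by (meson LeastI_ex all_not_in_conv)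
  moreover have "enat (LEAST k. k \<in> ?A) \<le> return_time Z s \<omega>"
    unfolding return_time_def by (intro INF_greatest) (simp add: Least_le)
  ultimately have "n \<in> ?A" using lower[of "LEAST k. k \<in> ?A"] r by auto
  then show "Z n \<omega> = s \<and> (\<forall>k. 0 < k \<and> k < n \<longrightarrow> Z k \<omega> \<noteq> s)" using lower by fastforce
next
  assume a: "Z n \<omega> = s \<and> (\<forall>k. 0 < k \<and> k < n \<longrightarrow> Z k \<omega> \<noteq> s)"
  show "return_time Z s \<omega> = enat n"
    unfolding return_time_def
  proof (rule antisym)
    show "(INF k\<in>{k. 0 < k \<and> Z k \<omega> = s}. enat k) \<le> enat n" using a assms by (intro INF_lower) auto
    show "enat n \<le> (INF k\<in>{k. 0 < k \<and> Z k \<omega> = s}. enat k)"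
      using a by (intro INF_greatest) (auto simp: not_less[symmetric])
  qed
qed


section \<open>Green functions of group random walks\<close>

lemma expect_eq_infsum:
  fixes f :: "'a \<Rightarrow> real"
  assumes "set_pmf p \<subseteq> A" "\<And>x. \<bar>f x\<bar> \<le> c"
  shows "expect p f = (\<Sum>\<^sub>\<infinity>x\<in>A. pmf p x * f x)"
proof -
  have c: "0 \<le> c" using assms(2)[of undefined] by linarith
  have "Infinite_Set_Sum.abs_summable_on (\<lambda>x. c * pmf p x) UNIV"
    by (intro abs_summable_on_cmult_right pmf_abs_summable)
  then have "Infinite_Set_Sum.abs_summable_on (\<lambda>x. pmf p x * f x) UNIV"
    by (rule abs_summable_on_comparison_test)
       (use mult_left_mono[OF assms(2) pmf_nonneg] c in \<open>simp add: abs_mult mult.commute[of c]\<close>)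
  then have "expect p f = (\<Sum>\<^sub>\<infinity>x. pmf p x * f x)"
    by (simp add: pmf_expectation_eq_infsetsum infsetsum_infsum)
  also have "\<dots> = (\<Sum>\<^sub>\<infinity>x\<in>A. pmf p x * f x)"
    by (rule infsum_cong_neutral) (use assms(1) in \<open>auto simp: set_pmf_eq\<close>)
  finally show ?thesis .
qed

lemma expect_group_trans:
  fixes H (structure) and f :: "'a \<Rightarrow> real"
  assumes "group H" "set_pmf \<nu> \<subseteq> carrier H" "x \<in> carrier H"
    and "\<And>y. y \<in> carrier H \<Longrightarrow> \<bar>f y\<bar> \<le> c"
  shows "(\<Sum>\<^sub>\<infinity>w\<in>carrier H. group_trans H \<nu> x w * f w) = expect \<nu> (\<lambda>g. f (x \<otimes> g))"
proof -
  interpret group H by (rule assms(1))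
  let ?f = "\<lambda>g. if g \<in> carrier H then f (x \<otimes> g) else 0"
  have bij: "bij_betw ((\<otimes>) x) (carrier H) (carrier H)"
    using assms(3) by (intro bij_betwI[where g = "(\<otimes>) (inv x)"]) (auto simp flip: m_assoc)
  have "(\<Sum>\<^sub>\<infinity>w\<in>carrier H. group_trans H \<nu> x w * f w) =
      (\<Sum>\<^sub>\<infinity>g\<in>carrier H. group_trans H \<nu> x (x \<otimes> g) * f (x \<otimes> g))"
    by (rule infsum_reindex_bij_betw[OF bij, symmetric])
  also have "\<dots> = (\<Sum>\<^sub>\<infinity>g\<in>carrier H. pmf \<nu> g * ?f g)"
    using assms(3) by (intro infsum_cong) (simp add: group_trans_def flip: m_assoc)
  also have "\<dots> = expect \<nu> ?f"
    using assms by (intro expect_eq_infsum[symmetric, where c = "\<bar>c\<bar>"]) (auto intro!: order_trans[OF assms(4) abs_ge_self])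
  also have "\<dots> = expect \<nu> (\<lambda>g. f (x \<otimes> g))"
    using assms(2) by (intro expect_cong) auto
  finally show ?thesis .
qed

lemma nstep_prob_group:
  fixes H (structure)
  assumes "group H" "set_pmf \<nu> \<subseteq> carrier H" "x \<in> carrier H"
  shows "nstep_prob (carrier H) (group_trans H \<nu>) (Suc n) x y =
      expect \<nu> (\<lambda>g. nstep_prob (carrier H) (group_trans H \<nu>) n (x \<otimes> g) y)"
    and "0 \<le> nstep_prob (carrier H) (group_trans H \<nu>) n x y"
    and "nstep_prob (carrier H) (group_trans H \<nu>) n x y \<le> 1"
proof -
  interpret group H by (rule assms(1))
  let ?p = "nstep_prob (carrier H) (group_trans H \<nu>)"
  have b: "(0 \<le> ?p n x y \<and> ?p n x y \<le> 1) \<and> ?p (Suc n) x y = expect \<nu> (\<lambda>g. ?p n (x \<otimes> g) y)"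
    if "x \<in> carrier H" for n x
    using that
  proof (induction n arbitrary: x)
    case 0
    show ?case
      by (simp, rule expect_group_trans[where c = 1]) (use assms 0 in auto)
  next
    case (Suc n)
    have g: "x \<otimes> g \<in> carrier H" if "g \<in> set_pmf \<nu>" for g using that assms Suc.prems by auto
    have "0 \<le> ?p (Suc n) x y \<and> ?p (Suc n) x y \<le> 1"
      if "x \<in> carrier H" for x
    proof -
      have "?p (Suc n) x y = expect \<nu> (\<lambda>g. ?p n (x \<otimes> g) y)" using Suc.IH that by blast
      then show ?thesis using Suc.IH assms that
        by (auto simp del: nstep_prob.simps intro!: expect_nonneg expect_le)
    qed
    then show ?case
      by (subst nstep_prob.simps(2)[of _ _ "Suc n"], subst expect_group_trans[where c = 1])
         (use assms Suc.prems in \<open>auto simp del: nstep_prob.simps simp: abs_le_iff intro: order_trans[of _ 0]\<close>)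
  qed
  show "?p (Suc n) x y = expect \<nu> (\<lambda>g. ?p n (x \<otimes> g) y)" "0 \<le> ?p n x y" "?p n x y \<le> 1"
    using b[OF assms(3)] by auto
qed

text \<open>
  Iterating the equation \<open>N\<close> times yields the first \<open>N\<close> terms of the Green series plus a
  remainder of order \<open>t ^ N\<close>. Bounded solutions are therefore unique; this identifies generating
  functions that are known only through their first-step equation.
\<close>
lemma green_unique:
  fixes H (structure) and V :: "'a \<Rightarrow> real"
  assumes "group H" "set_pmf \<nu> \<subseteq> carrier H" "x \<in> carrier H"
    and t: "0 \<le> t" "t < 1"
    and V: "\<And>h. h \<in> carrier H \<Longrightarrow> V h = u * of_bool (h = y) + t * expect \<nu> (\<lambda>g. V (h \<otimes> g))"
    and bound: "\<And>h. h \<in> carrier H \<Longrightarrow> \<bar>V h\<bar> \<le> c"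
  shows "V x = u * green (carrier H) (group_trans H \<nu>) x y t"
proof -
  interpret group H by (rule assms(1))
  let ?p = "nstep_prob (carrier H) (group_trans H \<nu>)"
  define S where "S = (\<lambda>N h. u * (\<Sum>n<N. ?p n h y * t ^ n))"
  have S: "S (Suc N) h = u * of_bool (h = y) + t * expect \<nu> (\<lambda>g. S N (h \<otimes> g))"
    if "h \<in> carrier H" for N h
  proof -
    have hg: "h \<otimes> g \<in> carrier H" if "g \<in> set_pmf \<nu>" for g using that \<open>h \<in> carrier H\<close> assms by auto
    have "S (Suc N) h = u * (of_bool (h = y) + (\<Sum>n<N. ?p (Suc n) h y * t ^ Suc n))"
      unfolding S_def by (subst sum.lessThan_Suc_shift) (simp del: nstep_prob.simps(2))
    also have "(\<Sum>n<N. ?p (Suc n) h y * t ^ Suc n) =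
        (\<Sum>n<N. expect \<nu> (\<lambda>g. t * (?p n (h \<otimes> g) y * t ^ n)))"
      by (simp add: nstep_prob_group(1)[OF assms(1,2) that] mult_ac del: nstep_prob.simps)
    also have "\<dots> = expect \<nu> (\<lambda>g. \<Sum>n<N. t * (?p n (h \<otimes> g) y * t ^ n))"
      using nstep_prob_group(2,3)[OF assms(1,2) hg] t
      by (intro expect_sum[symmetric, where c = 1])
         (auto simp: abs_mult power_le_one intro!: mult_le_one)
    finally show ?thesis
      by (simp add: S_def distrib_left sum_distrib_left mult_ac flip: integral_mult_right_zero)
  qed
  have approx: "\<bar>V h - S N h\<bar> \<le> c * t ^ N" if "h \<in> carrier H" for h N
    using that
  proof (induction N arbitrary: h)
    case 0
    then show ?case using bound by (simp add: S_def)
  next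
    case (Suc N)
    have hg: "h \<otimes> g \<in> carrier H" if "g \<in> set_pmf \<nu>" for g using that Suc.prems assms by auto
    have Sb: "\<bar>S N h\<bar> \<le> c + c * t ^ N" if "h \<in> carrier H" for h
      using Suc.IH[OF that] bound[OF that] by linarith
    have "V h - S (Suc N) h = t * expect \<nu> (\<lambda>g. V (h \<otimes> g) - S N (h \<otimes> g))"
      using hg by (subst expect_diff[where c = c and d = "c + c * t ^ N"])
        (auto simp: V[OF Suc.prems] S[OF Suc.prems] bound Sb algebra_simps)
    moreover have "t * \<bar>expect \<nu> (\<lambda>g. V (h \<otimes> g) - S N (h \<otimes> g))\<bar> \<le> t * (c * t ^ N)"
      using hg Suc.IH by (intro mult_left_mono expect_abs_le t) auto
    ultimately show ?case using t by (simp add: abs_mult mult.left_commute)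
  qed
  have "(\<lambda>N. c * t ^ N) \<longlonglongrightarrow> 0"
    by (rule tendsto_mult_right_zero[OF LIMSEQ_realpow_zero[OF t]])
  then have "(\<lambda>N. V x - S N x) \<longlonglongrightarrow> 0"
    by (rule Lim_null_comparison[rotated])
       (use approx[OF assms(3)] in \<open>auto intro: always_eventually\<close>)
  then have "(\<lambda>N. S N x) \<longlonglongrightarrow> V x"
    using tendsto_diff[OF tendsto_const[of "V x"], of "\<lambda>N. V x - S N x" 0] by simp
  moreover have "summable (\<lambda>n. ?p n x y * t ^ n)"
    by (rule summable_comparison_test[OF _ summable_geometric[of t]])
       (use t nstep_prob_group(2,3)[OF assms(1-3)] in \<open>auto simp: mult_left_le_one_le\<close>)
  then have "(\<lambda>N. S N x) \<longlonglongrightarrow> u * green (carrier H) (group_trans H \<nu>) x y t"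
    unfolding S_def green_def by (intro tendsto_mult_left summable_LIMSEQ)
  ultimately show ?thesis by (rule LIMSEQ_unique)
qed

lemma green_bounds:
  fixes H (structure)
  assumes "group H" "set_pmf \<nu> \<subseteq> carrier H" "x \<in> carrier H" "0 \<le> t" "t < 1"
  shows "0 \<le> green (carrier H) (group_trans H \<nu>) x y t"
    and "(1 - t) * green (carrier H) (group_trans H \<nu>) x y t \<le> 1"
proof -
  let ?p = "nstep_prob (carrier H) (group_trans H \<nu>)"
  note b = nstep_prob_group(2,3)[OF assms(1-3)]
  have s: "summable (\<lambda>n. ?p n x y * t ^ n)"
    by (rule summable_comparison_test[OF _ summable_geometric[of t]])
       (use assms b in \<open>auto simp: mult_left_le_one_le\<close>)
  show "0 \<le> green (carrier H) (group_trans H \<nu>) x y t"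
    unfolding green_def by (rule suminf_nonneg[OF s]) (use assms b in auto)
  have "green (carrier H) (group_trans H \<nu>) x y t \<le> (\<Sum>n. t ^ n)"
    unfolding green_def
    by (rule suminf_le[OF _ s summable_geometric]) (use assms b in \<open>auto simp: mult_left_le_one_le\<close>)
  then show "(1 - t) * green (carrier H) (group_trans H \<nu>) x y t \<le> 1"
    using assms by (simp add: suminf_geometric field_simps)
qed

lemma isCont_green:
  fixes H (structure)
  assumes "group H" "set_pmf \<nu> \<subseteq> carrier H" "x \<in> carrier H" "0 \<le> t" "t < 1"
  shows "isCont (green (carrier H) (group_trans H \<nu>) x y) t"
proof -
  let ?p = "nstep_prob (carrier H) (group_trans H \<nu>)"
  obtain s where s: "t < s" "s < 1" using dense assms by blast
  have "summable (\<lambda>n. ?p n x y * s ^ n)"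
    by (rule summable_comparison_test[OF _ summable_geometric[of s]])
       (use assms s nstep_prob_group(2,3)[OF assms(1-3)] in \<open>auto simp: mult_left_le_one_le\<close>)
  then have "isCont (\<lambda>t. \<Sum>n. ?p n x y * t ^ n) t"
    by (rule isCont_powser) (use assms s in auto)
  then show ?thesis by (simp add: green_def[abs_def])
qed


section \<open>Words of the free product\<close>

locale free_product_walk =
  fixes G :: "nat \<Rightarrow> ('a, 'b) monoid_scheme"
    and I :: "nat set"
    and \<alpha> :: "nat \<Rightarrow> real"
    and \<mu> :: "nat \<Rightarrow> 'a pmf"
  assumes fin: "finite I"
    and grp: "\<And>i. i \<in> I \<Longrightarrow> group (G i)"
    and supp: "\<And>i. i \<in> I \<Longrightarrow> set_pmf (\<mu> i) \<subseteq> carrier (G i) - {\<one>\<^bsub>G i\<^esub>}"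
    and alpha_pos: "\<And>i. i \<in> I \<Longrightarrow> \<alpha> i > 0"
    and alpha_sum: "(\<Sum>i\<in>I. \<alpha> i) = 1"
begin

abbreviation "B \<equiv> blocks G I"
abbreviation "W \<equiv> carrier (free_product G I)"

abbreviation star (infixl \<open>\<star>\<close> 70) where
  "x \<star> y \<equiv> foldr (mult_block G) x y"

text \<open>
  The words whose component in the factor \<open>i\<close> is trivial. The free product is the disjoint union
  of the cosets \<open>h (off i)\<close>, where \<open>h\<close> ranges over the factor \<open>i\<close>.
\<close>
definition off :: "nat \<Rightarrow> (nat \<times> 'a) list set" where
  "off i = {w. w = [] \<or> fst (hd w) \<noteq> i}"

lemma Nil_off [simp]: "[] \<in> off i"
  by (simp add: off_def)

lemma Cons_off [simp]: "a # w \<in> off i \<longleftrightarrow> fst a \<noteq> i"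
  by (simp add: off_def)

lemma Nil_W [simp]: "[] \<in> W"
  by (simp add: free_product_simps)

lemma Cons_W [simp]: "(i, g) # w \<in> W \<longleftrightarrow> (i, g) \<in> B \<and> w \<in> W \<and> w \<in> off i"
  by (cases w) (auto simp: free_product_simps)

lemma append_W: "u @ v \<in> W \<Longrightarrow> u \<in> W \<and> v \<in> W"
  by (auto simp: free_product_simps successively_append_iff)

lemma star_closed [simp]: "x \<in> W \<Longrightarrow> y \<in> W \<Longrightarrow> x \<star> y \<in> W"
  using free_product_mult_closed[of I G, OF grp] by blast

lemma star_assoc: "x \<in> W \<Longrightarrow> y \<in> W \<Longrightarrow> z \<in> W \<Longrightarrow> x \<star> y \<star> z = x \<star> (y \<star> z)"
  using free_product_assoc[of I G, OF grp] by blast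

lemma star_Nil [simp]: "x \<in> W \<Longrightarrow> x \<star> [] = x"
proof (induction x)
  case (Cons a x)
  then show ?case by (cases a; cases x) auto
qed simp

lemma mult_block_off: "w \<in> off i \<Longrightarrow> mult_block G (i, g) w = (i, g) # w"
  by (cases w) (auto simp: off_def)

lemma star_append: "u @ v \<in> W \<Longrightarrow> u \<star> v = u @ v"
proof (induction u)
  case (Cons a u)
  then show ?case by (cases a) (simp add: mult_block_off)
qed simp

lemma block_mult_cases:
  assumes "(i, g) \<in> B" "y \<in> W"
  obtains (off) "y \<in> off i" "[(i, g)] \<star> y = (i, g) # y"
  | (cancel) h v where "y = (i, h) # v" "(i, h) \<in> B" "v \<in> W" "v \<in> off i"
      "g \<otimes>\<^bsub>G i\<^esub> h = \<one>\<^bsub>G i\<^esub>" "[(i, g)] \<star> y = v"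
  | (merge) h v where "y = (i, h) # v" "(i, h) \<in> B" "v \<in> W" "v \<in> off i"
      "g \<otimes>\<^bsub>G i\<^esub> h \<noteq> \<one>\<^bsub>G i\<^esub>" "[(i, g)] \<star> y = (i, g \<otimes>\<^bsub>G i\<^esub> h) # v"
proof (cases "y \<in> off i")
  case True
  then show ?thesis using off by (simp add: mult_block_off)
next
  case False
  then obtain h v where y: "y = (i, h) # v" by (cases y) (auto simp: off_def)
  show ?thesis
  proof (cases "g \<otimes>\<^bsub>G i\<^esub> h = \<one>\<^bsub>G i\<^esub>")
    case True
    show ?thesis by (rule cancel[OF y]) (use True y assms(2) in auto)
  next
    case False
    show ?thesis by (rule merge[OF y]) (use False y assms(2) in auto)
  qed
qed

lemma mult_block_snoc_cases:
  assumes "x \<in> W" "(i, g) \<in> B"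
  obtains (Nil) "x = []" "x \<star> [(i, g)] = [(i, g)]"
  | (append) u j h where "x = u @ [(j, h)]" "j \<noteq> i" "x \<star> [(i, g)] = x @ [(i, g)]"
  | (cancel) u h where "x = u @ [(i, h)]" "x \<star> [(i, g)] = u"
  | (merge) u h k where "x = u @ [(i, h)]" "(i, k) \<in> B" "x \<star> [(i, g)] = u @ [(i, k)]"
proof (cases x rule: rev_cases)
  case Nil
  then show ?thesis using that by simp
next
  case (snoc u a)
  obtain j h where a: "a = (j, h)" by fastforce
  have x: "x = u @ [(j, h)]" using snoc a by simp
  have u: "u \<in> W" using append_W assms(1) x by blast
  have jh: "(j, h) \<in> B" using assms(1) x by (auto simp: free_product_simps)
  have g: "[(i, g)] \<in> W" using assms(2) by simp
  have e: "x \<star> [(i, g)] = u \<star> ([(j, h)] \<star> [(i, g)])" by (simp add: x)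
  show ?thesis
  proof (cases "j = i")
    case False
    have "x @ [(i, g)] \<in> W"
      using assms False by (auto simp: x free_product_simps successively_append_iff)
    then have "x \<star> [(i, g)] = x @ [(i, g)]" by (rule star_append)
    then show ?thesis using append[OF x False] by blast
  next
    case True
    interpret Gi: group "G i" using grp assms by (auto simp: blocks_def)
    show ?thesis
    proof (cases "h \<otimes>\<^bsub>G i\<^esub> g = \<one>\<^bsub>G i\<^esub>")
      case c: True
      then have "x \<star> [(i, g)] = u" using e True u by simp
      then show ?thesis using cancel x True by blast
    next
      case False
      let ?k = "h \<otimes>\<^bsub>G i\<^esub> g"
      have k: "(i, ?k) \<in> B" using jh assms False True by (auto simp: blocks_def)
      have "u @ [(i, ?k)] \<in> W"
        using assms k True by (auto simp: x free_product_simps successively_append_iff)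
      then have "x \<star> [(i, g)] = u @ [(i, ?k)]" using e True False star_append by simp
      then show ?thesis using merge x True k by blast
    qed
  qed
qed

text \<open>
  A right multiplication by one block acts at the end of a word, so it can affect the first block
  only by replacing it within its factor or by emptying the word. Hence the walk cannot leave
  \<open>off i\<close> except from the empty word.
\<close>
lemma off_star_block:
  assumes "x \<in> W" "x \<in> off i" "x \<noteq> []" "(j, g) \<in> B"
  shows "x \<star> [(j, g)] \<in> off i"
  using assms(1,4)
proof (cases rule: mult_block_snoc_cases)
  case (merge u h k)
  then show ?thesis using assms by (cases u) auto
next
  case (cancel u h)
  then show ?thesis using assms by (cases u) auto
next
  case (append u k h)
  then show ?thesis using assms by (cases u) auto
qed (use assms in auto)

lemma length_star_block:
  assumes "x \<in> W" "(j, g) \<in> B"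
  shows "\<bar>real (length (x \<star> [(j, g)])) - real (length x)\<bar> \<le> 1"
  using assms by (cases rule: mult_block_snoc_cases) auto

lemma length_mult_block: "length (mult_block G a w) \<le> Suc (length w)"
  by (cases "(G, a, w)" rule: mult_block.cases) auto

lemma length_star: "length (x \<star> y) \<le> length x + length y"
proof (induction x)
  case (Cons a x)
  then show ?case using length_mult_block[of a "x \<star> y"] by simp
qed simp

text \<open>
  The word \<open>u\<close> is the inverse of \<open>x\<close>, block by block. In the product \<open>x \<star> y\<close> each cancelled pair
  of blocks costs two units of length and lengthens the common prefix of \<open>y\<close> and \<open>u\<close> by one; the
  first pair that does not cancel may merge, at a cost of one. The sum is the length of that common
  prefix, written as a sum of indicators so that its expectation is a sum of probabilities.
\<close>
lemma length_star_ge: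
  assumes "x \<in> W"
  shows "\<exists>u. length u = length x \<and> set u \<subseteq> B \<and>
    (\<forall>y\<in>W. length x + length y \<le>
      length (x \<star> y) + 1 + 2 * (\<Sum>c<length x. of_bool (take (Suc c) y = take (Suc c) u)))"
  using assms
proof (induction x rule: rev_induct)
  case Nil
  then show ?case by auto
next
  case (snoc a x)
  obtain i g where a: "a = (i, g)" by fastforce
  have x: "x \<in> W" using append_W snoc.prems by blast
  have ig: "(i, g) \<in> B" using snoc.prems by (auto simp: a free_product_simps)
  interpret Gi: group "G i" using grp ig by (auto simp: blocks_def)
  have g: "g \<in> carrier (G i)" "g \<noteq> \<one>\<^bsub>G i\<^esub>" using ig by (auto simp: blocks_def)
  obtain u where u: "length u = length x" "set u \<subseteq> B"
    "\<And>y. y \<in> W \<Longrightarrow> length x + length y \<le>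
      length (x \<star> y) + 1 + 2 * (\<Sum>c<length x. of_bool (take (Suc c) y = take (Suc c) u))"
    using snoc.IH[OF x] by blast
  let ?u = "(i, inv\<^bsub>G i\<^esub> g) # u"
  have iu: "(i, inv\<^bsub>G i\<^esub> g) \<in> B" using ig by (auto simp: blocks_def)
  have "length (x @ [a]) + length y \<le> length ((x @ [a]) \<star> y) + 1 +
      2 * (\<Sum>c<length (x @ [a]). of_bool (take (Suc c) y = take (Suc c) ?u))"
    if y: "y \<in> W" for y
  proof -
    have e: "(x @ [a]) \<star> y = x \<star> ([(i, g)] \<star> y)" by (simp add: a)
    show ?thesis using ig y
    proof (cases rule: block_mult_cases)
      case off
      have "x @ (i, g) # y \<in> W"
        using snoc.prems off(1) y ig
        by (cases y) (auto simp: a free_product_simps successively_append_iff)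
      then show ?thesis using e off(2) star_append by simp
    next
      case (merge h v)
      have h: "h \<in> carrier (G i)" using merge(2) by (auto simp: blocks_def)
      have "(i, g \<otimes>\<^bsub>G i\<^esub> h) \<in> B" using merge(5) ig h by (auto simp: blocks_def)
      then have "x @ (i, g \<otimes>\<^bsub>G i\<^esub> h) # v \<in> W"
        using snoc.prems merge(3,4)
        by (cases v) (auto simp: a free_product_simps successively_append_iff)
      then show ?thesis using e merge(1,6) star_append by simp
    next
      case (cancel h v)
      have h: "h \<in> carrier (G i)" using cancel(2) by (auto simp: blocks_def)
      have "h = inv\<^bsub>G i\<^esub> g" using cancel(5) g h Gi.inv_equality[of h g] Gi.inv_comm
        by (metis Gi.inv_equality Gi.inv_inv)
      then have "(take (Suc c) y = take (Suc c) ?u) \<longleftrightarrow> take c v = take c u" for c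
        by (simp add: cancel(1))
      then have "(\<Sum>c<length (x @ [a]). of_bool (take (Suc c) y = take (Suc c) ?u)) =
          (\<Sum>c<Suc (length x). of_bool (take c v = take c u) :: nat)" by simp
      also have "\<dots> = Suc (\<Sum>c<length x. of_bool (take (Suc c) v = take (Suc c) u))"
        by (subst sum.lessThan_Suc_shift) simp
      finally show ?thesis using e u(3)[OF cancel(3)] cancel(1,6) by simp
    qed
  qed
  then show ?case using u(1,2) iu by (intro exI[of _ ?u]) auto
qed


section \<open>The random walk\<close>

definition index_pmf :: "nat pmf" where
  "index_pmf = embed_pmf (\<lambda>i. if i \<in> I then \<alpha> i else 0)"

lemma pmf_index: "pmf index_pmf i = (if i \<in> I then \<alpha> i else 0)"
  unfolding index_pmf_def
proof (rule pmf_embed_pmf)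
  show "0 \<le> (if i \<in> I then \<alpha> i else 0)" for i
    using alpha_pos[of i] by auto
  have "(\<integral>\<^sup>+i. ennreal (if i \<in> I then \<alpha> i else 0) \<partial>count_space UNIV) =
      (\<integral>\<^sup>+i. ennreal (\<alpha> i) * indicator I i \<partial>count_space UNIV)"
    by (intro nn_integral_cong) (auto simp: indicator_def)
  also have "\<dots> = (\<Sum>i\<in>I. ennreal (\<alpha> i))"
    by (simp add: nn_integral_count_space_indicator[symmetric] nn_integral_count_space_finite fin)
  also have "\<dots> = ennreal (\<Sum>i\<in>I. \<alpha> i)"
    by (rule sum_ennreal) (use alpha_pos in fastforce)
  finally show "(\<integral>\<^sup>+i. ennreal (if i \<in> I then \<alpha> i else 0) \<partial>count_space UNIV) = 1"
    by (simp add: alpha_sum)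
qed

lemma set_index: "set_pmf index_pmf = I"
  using alpha_pos by (force simp: set_pmf_eq pmf_index)

definition step :: "(nat \<times> 'a) list pmf" where
  "step = bind_pmf index_pmf (\<lambda>i. map_pmf (\<lambda>g. [(i, g)]) (\<mu> i))"

lemma step_block:
  assumes "s \<in> set_pmf step"
  obtains i g where "s = [(i, g)]" "i \<in> I" "g \<in> set_pmf (\<mu> i)" "(i, g) \<in> B"
  using assms supp by (fastforce simp: step_def set_index blocks_def)

lemma mu_B: "i \<in> I \<Longrightarrow> g \<in> set_pmf (\<mu> i) \<Longrightarrow> (i, g) \<in> B"
  using supp by (auto simp: blocks_def)

lemma step_W: "s \<in> set_pmf step \<Longrightarrow> s \<in> W"
  by (erule step_block) simp

lemma expect_step:
  assumes "\<And>i g. i \<in> I \<Longrightarrow> g \<in> set_pmf (\<mu> i) \<Longrightarrow> \<bar>f [(i, g)]\<bar> \<le> c"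
  shows "expect step f = (\<Sum>i\<in>I. \<alpha> i * expect (\<mu> i) (\<lambda>g. f [(i, g)]))"
proof -
  have "expect step f = expect index_pmf (\<lambda>i. expect (\<mu> i) (\<lambda>g. f [(i, g)]))"
    unfolding step_def by (subst expect_bind_pmf[where c = c]) (use assms in \<open>auto simp: set_index\<close>)
  also have "\<dots> = (\<Sum>i\<in>I. expect (\<mu> i) (\<lambda>g. f [(i, g)]) * pmf index_pmf i)"
    by (rule integral_measure_pmf_real) (auto simp: fin set_index)
  also have "\<dots> = (\<Sum>i\<in>I. \<alpha> i * expect (\<mu> i) (\<lambda>g. f [(i, g)]))"
    by (rule sum.cong) (auto simp: pmf_index)
  finally show ?thesis .
qed

text \<open>
  The law after \<open>n\<close> steps, by recursion on the first step: the arguments below condition on the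
  first increment.
\<close>
primrec walk :: "nat \<Rightarrow> (nat \<times> 'a) list \<Rightarrow> (nat \<times> 'a) list pmf" where
  "walk 0 x = return_pmf x"
| "walk (Suc n) x = bind_pmf step (\<lambda>s. walk n (x \<star> s))"

lemma walk_W: "x \<in> W \<Longrightarrow> y \<in> set_pmf (walk n x) \<Longrightarrow> y \<in> W"
  by (induction n arbitrary: x) (auto, metis star_closed step_W)

lemma walk_translate:
  assumes "x \<in> W" "y \<in> W"
  shows "walk n (x \<star> y) = map_pmf ((\<star>) x) (walk n y)"
  using assms(2)
proof (induction n arbitrary: y)
  case (Suc n)
  then show ?case
    by (auto simp: map_bind_pmf star_assoc[OF assms(1)] step_W intro!: bind_pmf_cong)
qed simp

lemma walk_from: "x \<in> W \<Longrightarrow> walk n x = map_pmf ((\<star>) x) (walk n [])"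
  using walk_translate[of x "[]" n] by simp

lemma walk_add: "walk (m + n) x = bind_pmf (walk m x) (walk n)"
  by (induction m arbitrary: x) (simp_all add: bind_return_pmf bind_assoc_pmf)

lemma walk_length:
  assumes "x \<in> W" "y \<in> set_pmf (walk n x)"
  shows "\<bar>real (length y) - real (length x)\<bar> \<le> real n"
  using assms
proof (induction n arbitrary: x)
  case (Suc n)
  then obtain s where s: "s \<in> set_pmf step" "y \<in> set_pmf (walk n (x \<star> s))" by auto
  have "\<bar>real (length y) - real (length (x \<star> s))\<bar> \<le> real n"
    using Suc.IH[of "x \<star> s"] Suc.prems s step_W by simp
  moreover have "\<bar>real (length (x \<star> s)) - real (length x)\<bar> \<le> 1"
    using s(1) Suc.prems length_star_block by (auto elim: step_block)
  ultimately show ?case by simp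
qed simp

lemma walk_length_Nil: "y \<in> set_pmf (walk n []) \<Longrightarrow> real (length y) \<le> real n"
  using walk_length[of "[]" y n] by simp


section \<open>Excursions from the identity\<close>

primrec first_hit :: "nat \<Rightarrow> (nat \<times> 'a) list \<Rightarrow> real" where
  "first_hit 0 x = of_bool (x = [])"
| "first_hit (Suc n) x = of_bool (x \<noteq> []) * expect step (\<lambda>s. first_hit n (x \<star> s))"

lemma first_hit_bounds: "0 \<le> first_hit n x" "first_hit n x \<le> 1"
proof -
  have "0 \<le> first_hit n x \<and> first_hit n x \<le> 1"
    by (induction n arbitrary: x) (auto intro!: expect_nonneg expect_le)
  then show "0 \<le> first_hit n x" "first_hit n x \<le> 1" by auto
qed

lemma first_hit_abs: "\<bar>first_hit n x\<bar> \<le> 1"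
  using first_hit_bounds[of n x] by simp

lemma first_hit_Nil [simp]: "first_hit n [] = of_bool (n = 0)"
  by (cases n) auto

lemma hit_by_Suc:
  assumes "x \<noteq> []"
  shows "(\<Sum>k\<le>Suc n. first_hit k x) = expect step (\<lambda>s. \<Sum>k\<le>n. first_hit k (x \<star> s))"
  by (subst sum.atMost_Suc_shift, subst expect_sum[where c = 1])
     (use assms first_hit_abs in auto)

lemma hit_by_bounds: "0 \<le> (\<Sum>k\<le>n. first_hit k x)" "(\<Sum>k\<le>n. first_hit k x) \<le> 1"
proof -
  show *: "0 \<le> (\<Sum>k\<le>n. first_hit k x)" for n x
    by (intro sum_nonneg first_hit_bounds)
  show "(\<Sum>k\<le>n. first_hit k x) \<le> 1"
  proof (induction n arbitrary: x)
    case (Suc n)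
    show ?case
    proof (cases "x = []")
      case True
      then show ?thesis by (subst sum.atMost_Suc_shift) simp
    next
      case False
      show ?thesis unfolding hit_by_Suc[OF False]
        by (rule expect_le) (use Suc * in auto)
    qed
  qed simp
qed

text \<open>
  The probability that the walk from the empty word takes its first step outside the factor \<open>i\<close>
  and returns for the first time at time \<open>k + 1\<close>. The shift by one is undone in \<open>ret_gf\<close>, which is
  \<open>Hbar\<close> in terms of the walk.
\<close>
definition ret :: "nat \<Rightarrow> nat \<Rightarrow> real" where
  "ret i k = (\<Sum>j\<in>I - {i}. \<alpha> j * expect (\<mu> j) (\<lambda>g. first_hit k [(j, g)]))"

lemma ret_nonneg: "0 \<le> ret i k"
  unfolding ret_def
  by (intro sum_nonneg mult_nonneg_nonneg expect_nonneg first_hit_bounds)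
     (use alpha_pos in \<open>auto intro: less_imp_le\<close>)

lemma alpha_others: "i \<in> I \<Longrightarrow> (\<Sum>j\<in>I - {i}. \<alpha> j) = 1 - \<alpha> i"
  using alpha_sum fin by (simp add: sum_diff1)

lemma alpha_le: "i \<in> I \<Longrightarrow> \<alpha> i \<le> 1"
proof -
  assume "i \<in> I"
  moreover have "0 \<le> (\<Sum>j\<in>I - {i}. \<alpha> j)"
    using alpha_pos by (intro sum_nonneg) (auto intro: less_imp_le)
  ultimately show ?thesis using alpha_others by force
qed

lemma sum_ret:
  "(\<Sum>k\<le>n. ret i k) = (\<Sum>j\<in>I - {i}. \<alpha> j * expect (\<mu> j) (\<lambda>g. \<Sum>k\<le>n. first_hit k [(j, g)]))"
  unfolding ret_def
  by (subst sum.swap, subst expect_sum[where c = 1])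
     (auto simp: sum_distrib_left first_hit_abs)

lemma sum_ret_le:
  assumes "i \<in> I"
  shows "(\<Sum>k\<le>n. ret i k) \<le> 1 - \<alpha> i"
proof -
  have "(\<Sum>k\<le>n. ret i k) \<le> (\<Sum>j\<in>I - {i}. \<alpha> j * 1)"
    unfolding sum_ret
    by (intro sum_mono mult_left_mono expect_le hit_by_bounds)
       (use alpha_pos in \<open>auto intro: less_imp_le\<close>)
  then show ?thesis using alpha_others[OF assms] by simp
qed

lemma summable_ret:
  assumes "i \<in> I"
  shows "summable (ret i)"
proof (rule summableI_nonneg_bounded)
  show "sum (ret i) {..<n} \<le> 1 - \<alpha> i" for n
    using sum_mono2[of "{..n}" "{..<n}" "ret i"] sum_ret_le[OF assms, of n] ret_nonneg by force
qed (rule ret_nonneg)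

definition ret_gf :: "nat \<Rightarrow> real \<Rightarrow> real" where
  "ret_gf i z = (\<Sum>k. ret i k * z ^ Suc k)"

lemma summable_ret_power:
  assumes "i \<in> I" "0 \<le> z" "z \<le> 1"
  shows "summable (\<lambda>k. ret i k * z ^ k)"
  by (rule summable_comparison_test[OF _ summable_ret[OF assms(1)]])
     (use assms ret_nonneg in \<open>auto simp: mult_left_le power_le_one\<close>)

lemma ret_gf_factor:
  assumes "i \<in> I" "0 \<le> z" "z \<le> 1"
  shows "ret_gf i z = z * (\<Sum>k. ret i k * z ^ k)"
  unfolding ret_gf_def
  by (subst suminf_mult[OF summable_ret_power[OF assms], symmetric]) (simp add: algebra_simps)

lemma ret_gf_bounds:
  assumes "i \<in> I" "0 \<le> z" "z \<le> 1"
  shows "0 \<le> ret_gf i z" "ret_gf i z \<le> z * (1 - \<alpha> i)"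
proof -
  have "(\<Sum>k. ret i k * z ^ k) \<le> (\<Sum>k. ret i k)"
    by (intro suminf_le summable_ret_power summable_ret assms)
       (use assms ret_nonneg in \<open>auto simp: mult_left_le power_le_one\<close>)
  also have "\<dots> \<le> 1 - \<alpha> i"
    by (rule suminf_le_const[OF summable_ret[OF assms(1)]])
       (metis lessThan_Suc_atMost lessThan_0 sum.empty not0_implies_Suc sum_ret_le[OF assms(1)]
          alpha_le[OF assms(1)] diff_ge_0_iff_ge)
  finally show "ret_gf i z \<le> z * (1 - \<alpha> i)"
    using ret_gf_factor[OF assms] assms by (simp add: mult_left_mono)
  show "0 \<le> ret_gf i z" unfolding ret_gf_def
    using summable_mult2[OF summable_ret_power[OF assms], of z] assms ret_nonneg
    by (intro suminf_nonneg) (auto simp: mult_ac)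
qed

definition \<xi> :: "nat \<Rightarrow> real \<Rightarrow> real" where
  "\<xi> i z = \<alpha> i * z / (1 - ret_gf i z)"

lemma ret_gf_less_1:
  assumes "i \<in> I" "0 \<le> z" "z \<le> 1"
  shows "ret_gf i z < 1"
proof -
  have "z * (1 - \<alpha> i) \<le> 1 - \<alpha> i" using assms alpha_le by (simp add: mult_left_le_one_le)
  then show ?thesis using ret_gf_bounds[OF assms] alpha_pos[OF assms(1)] by linarith
qed

lemma xi_pos: "i \<in> I \<Longrightarrow> 0 < z \<Longrightarrow> z \<le> 1 \<Longrightarrow> 0 < \<xi> i z"
  unfolding \<xi>_def using ret_gf_less_1[of i z] alpha_pos by simp

lemma xi_le_1:
  assumes "i \<in> I" "0 \<le> z" "z \<le> 1"
  shows "\<xi> i z \<le> 1"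
proof -
  have "\<alpha> i * z \<le> 1 - ret_gf i z"
    using ret_gf_bounds[OF assms] assms by (simp add: algebra_simps)
  then show ?thesis unfolding \<xi>_def using ret_gf_less_1[OF assms] by simp
qed

lemma xi_less_1:
  assumes "i \<in> I" "0 \<le> z" "z < 1"
  shows "\<xi> i z < 1"
proof -
  have "\<alpha> i * z < 1 - ret_gf i z"
    using ret_gf_bounds[of i z] assms by (simp add: algebra_simps)
  then show ?thesis unfolding \<xi>_def using ret_gf_less_1[of i z] assms by simp
qed

text \<open>
  The walk either takes a step in the factor \<open>i\<close> at once, or makes an excursion and is back where
  it began.
\<close>
lemma xi_eq: "i \<in> I \<Longrightarrow> 0 \<le> z \<Longrightarrow> z \<le> 1 \<Longrightarrow> \<alpha> i * z + ret_gf i z * \<xi> i z = \<xi> i z"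
  unfolding \<xi>_def using ret_gf_less_1[of i z] by (simp add: field_simps)


section \<open>Leaving a coset\<close>

text \<open>
  Examples of such \<open>q\<close> are the probability of being in a set \<open>Q\<close> at time \<open>n\<close>, if \<open>Q\<close> is disjoint
  from the coset \<open>x (off i)\<close>, and the probability of having hit the empty word by time \<open>n\<close>, if it
  is not in the coset. In both cases \<open>q\<close> solves the discrete heat equation on the coset with
  initial value 0, so only paths that leave the coset contribute.
\<close>
definition caloric_off :: "nat \<Rightarrow> (nat \<times> 'a) list \<Rightarrow> (nat \<Rightarrow> (nat \<times> 'a) list \<Rightarrow> real) \<Rightarrow> bool" where
  "caloric_off i x q \<longleftrightarrow>
     (\<forall>n. \<forall>w\<in>W. 0 \<le> q n w \<and> q n w \<le> 1) \<and>
     (\<forall>y\<in>off i \<inter> W. q 0 (x \<star> y) = 0 \<and>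
        (\<forall>n. q (Suc n) (x \<star> y) = expect step (\<lambda>s. q n (x \<star> y \<star> s))))"

lemma caloric_off_bounds:
  assumes "caloric_off i x q" "w \<in> W"
  shows "0 \<le> q n w" "q n w \<le> 1" "\<bar>q n w\<bar> \<le> 1"
  using assms by (auto simp: caloric_off_def abs_le_iff intro: order_trans[of _ 0])

lemma prob_walk_Suc:
  "measure_pmf.prob (walk (Suc n) x) Q = expect step (\<lambda>s. measure_pmf.prob (walk n (x \<star> s)) Q)"
  by (simp add: prob_bind_pmf)

lemma caloric_off_prob:
  assumes "\<And>y. y \<in> off i \<Longrightarrow> y \<in> W \<Longrightarrow> x \<star> y \<notin> Q"
  shows "caloric_off i x (\<lambda>n w. measure_pmf.prob (walk n w) Q)"
  unfolding caloric_off_def prob_walk_Suc using assms by (simp add: indicator_def)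

text \<open>
  A path from \<open>x \<star> y\<close> leaves the coset only through \<open>x\<close>. By translation, its first visit to \<open>x\<close> is
  the first visit of the walk from \<open>y\<close> to the empty word.
\<close>
lemma caloric_off_renewal:
  assumes q: "caloric_off i x q" and x: "x \<in> W" and y: "y \<in> W" "y \<in> off i"
  shows "q n (x \<star> y) = (\<Sum>k\<le>n. first_hit k y * q (n - k) x)"
  using y
proof (induction n arbitrary: y)
  case 0
  then show ?case using q x by (cases "y = []") (auto simp: caloric_off_def)
next
  case (Suc n)
  show ?case
  proof (cases "y = []")
    case True
    then show ?thesis using x by (subst sum.atMost_Suc_shift) simp
  next
    case False
    have "q (Suc n) (x \<star> y) = expect step (\<lambda>s. q n (x \<star> y \<star> s))"
      using q Suc.prems by (auto simp: caloric_off_def)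
    also have "\<dots> = expect step (\<lambda>s. \<Sum>k\<le>n. first_hit k (y \<star> s) * q (n - k) x)"
    proof (rule expect_cong)
      fix s assume s: "s \<in> set_pmf step"
      then have "y \<star> s \<in> off i" using Suc.prems False by (auto elim: step_block intro: off_star_block)
      then show "q n (x \<star> y \<star> s) = (\<Sum>k\<le>n. first_hit k (y \<star> s) * q (n - k) x)"
        using Suc.IH[of "y \<star> s"] Suc.prems s step_W x by (simp add: star_assoc)
    qed
    also have "\<dots> = (\<Sum>k\<le>n. expect step (\<lambda>s. first_hit k (y \<star> s) * q (n - k) x))"
      using first_hit_abs caloric_off_bounds(3)[OF q x]
      by (intro expect_sum[where c = 1]) (auto simp: abs_mult mult_le_one)
    also have "\<dots> = (\<Sum>k\<le>Suc n. first_hit k y * q (Suc n - k) x)"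
      by (subst sum.atMost_Suc_shift) (use False in simp)
    finally show ?thesis .
  qed
qed

lemma caloric_off_Suc:
  assumes i: "i \<in> I" and q: "caloric_off i x q" and x: "x \<in> W"
  shows "q (Suc n) x = \<alpha> i * expect (\<mu> i) (\<lambda>g. q n (x \<star> [(i, g)])) + (\<Sum>k\<le>n. ret i k * q (n - k) x)"
proof -
  have "q (Suc n) x = q (Suc n) (x \<star> [])" using x by simp
  also have "\<dots> = expect step (\<lambda>s. q n (x \<star> [] \<star> s))"
    using q by (auto simp: caloric_off_def)
  also have "\<dots> = expect step (\<lambda>s. q n (x \<star> s))" using x by simp
  also have "\<dots> = (\<Sum>j\<in>I. \<alpha> j * expect (\<mu> j) (\<lambda>g. q n (x \<star> [(j, g)])))"
    using caloric_off_bounds(3)[OF q] x mu_B by (intro expect_step[where c = 1]) simp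
  also have "\<dots> = \<alpha> i * expect (\<mu> i) (\<lambda>g. q n (x \<star> [(i, g)])) +
      (\<Sum>j\<in>I - {i}. \<alpha> j * expect (\<mu> j) (\<lambda>g. q n (x \<star> [(j, g)])))"
    by (rule sum.remove[OF fin i])
  also have "(\<Sum>j\<in>I - {i}. \<alpha> j * expect (\<mu> j) (\<lambda>g. q n (x \<star> [(j, g)]))) =
      (\<Sum>j\<in>I - {i}. \<alpha> j * (\<Sum>k\<le>n. expect (\<mu> j) (\<lambda>g. first_hit k [(j, g)]) * q (n - k) x))"
  proof (intro sum.cong refl arg_cong2[where f = "(*)"])
    fix j assume j: "j \<in> I - {i}"
    have "expect (\<mu> j) (\<lambda>g. q n (x \<star> [(j, g)])) =
        expect (\<mu> j) (\<lambda>g. \<Sum>k\<le>n. first_hit k [(j, g)] * q (n - k) x)"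
      using j mu_B by (intro expect_cong caloric_off_renewal[OF q x]) auto
    also have "\<dots> = (\<Sum>k\<le>n. expect (\<mu> j) (\<lambda>g. first_hit k [(j, g)] * q (n - k) x))"
      using first_hit_abs caloric_off_bounds(3)[OF q x]
      by (intro expect_sum[where c = 1]) (auto simp: abs_mult mult_le_one)
    finally show "expect (\<mu> j) (\<lambda>g. q n (x \<star> [(j, g)])) =
        (\<Sum>k\<le>n. expect (\<mu> j) (\<lambda>g. first_hit k [(j, g)]) * q (n - k) x)" by simp
  qed
  also have "\<dots> = (\<Sum>k\<le>n. ret i k * q (n - k) x)"
    unfolding ret_def sum_distrib_left sum_distrib_right
    by (subst sum.swap) (simp add: mult_ac)
  finally show ?thesis .
qed

text \<open>
  Leaving the coset requires a step in the factor \<open>i\<close> from \<open>x\<close>, and such a step is ever taken with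
  probability \<open>\<xi> i 1\<close>. The hypothesis is restricted to times before \<open>n\<close> so that the bound can be
  used inside an induction on time.
\<close>
lemma caloric_off_le:
  assumes i: "i \<in> I" and q: "caloric_off i x q" and x: "x \<in> W" and t: "0 \<le> t"
    and le: "\<And>m g. m < n \<Longrightarrow> g \<in> set_pmf (\<mu> i) \<Longrightarrow> q m (x \<star> [(i, g)]) \<le> t"
  shows "q n x \<le> \<xi> i 1 * t"
  using le
proof (induction n rule: less_induct)
  case (less n)
  have xi: "0 \<le> \<xi> i 1" using xi_pos[OF i, of 1] by simp
  show ?case
  proof (cases n)
    case 0
    have "q 0 (x \<star> []) = 0" using q by (auto simp: caloric_off_def)
    then show ?thesis using 0 x xi t by simp
  next
    case (Suc m)
    have "(\<Sum>k\<le>m. ret i k * q (m - k) x) \<le> (\<Sum>k\<le>m. ret i k * (\<xi> i 1 * t))"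
    proof (intro sum_mono mult_left_mono ret_nonneg)
      fix k assume "k \<in> {..m}"
      show "q (m - k) x \<le> \<xi> i 1 * t"
        by (rule less.IH) (use less.prems Suc in auto)
    qed
    also have "\<dots> = (\<Sum>k\<le>m. ret i k) * (\<xi> i 1 * t)" by (simp add: sum_distrib_right)
    also have "\<dots> \<le> ret_gf i 1 * (\<xi> i 1 * t)"
      using xi t summable_ret[OF i] ret_nonneg
      by (intro mult_right_mono) (auto simp: ret_gf_def intro!: sum_le_suminf)
    finally have 1: "(\<Sum>k\<le>m. ret i k * q (m - k) x) \<le> ret_gf i 1 * (\<xi> i 1 * t)" .
    have "expect (\<mu> i) (\<lambda>g. q m (x \<star> [(i, g)])) \<le> t"
      using less.prems Suc caloric_off_bounds(1)[OF q] x mu_B i by (intro expect_le) auto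
    then have "\<alpha> i * expect (\<mu> i) (\<lambda>g. q m (x \<star> [(i, g)])) \<le> \<alpha> i * t"
      using alpha_pos[OF i] by simp
    then have "q n x \<le> \<alpha> i * t + ret_gf i 1 * (\<xi> i 1 * t)"
      using 1 caloric_off_Suc[OF i q x] Suc by simp
    also have "\<dots> = (\<alpha> i * 1 + ret_gf i 1 * \<xi> i 1) * t" by (simp add: algebra_simps)
    also have "\<dots> = \<xi> i 1 * t" using xi_eq[OF i, of 1] by simp
    finally show ?thesis .
  qed
qed

text \<open>To hit the empty word from a block of the factor \<open>i\<close>, the walk must leave the coset of that block.\<close>
lemma hit_by_le_xi:
  assumes "(i, h) \<in> B"
  shows "(\<Sum>k\<le>n. first_hit k [(i, h)]) \<le> \<xi> i 1"
proof -
  have i: "i \<in> I" using assms by (auto simp: blocks_def)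
  let ?q = "\<lambda>n w. \<Sum>k\<le>n. first_hit k w"
  have "caloric_off i [(i, h)] ?q"
    unfolding caloric_off_def
  proof (intro conjI allI ballI hit_by_bounds)
    fix y assume y: "y \<in> off i \<inter> W"
    then have ne: "[(i, h)] \<star> y \<noteq> []" by (simp add: mult_block_off)
    then show "(\<Sum>k\<le>0. first_hit k ([(i, h)] \<star> y)) = 0" by simp
    show "?q (Suc n) ([(i, h)] \<star> y) = expect step (\<lambda>s. ?q n ([(i, h)] \<star> y \<star> s))" for n
      by (rule hit_by_Suc[OF ne])
  qed
  then have "?q n [(i, h)] \<le> \<xi> i 1 * 1"
    by (rule caloric_off_le[OF i]) (use assms hit_by_bounds in auto)
  then show ?thesis by simp
qed

text \<open>
  If \<open>\<xi> j 1 = 1\<close>, then every excursion that starts outside the factor \<open>j\<close> returns almost surely.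
  In particular the walk hits the empty word almost surely from \<open>\<mu> i\<close>-almost every block of
  another factor \<open>i\<close>, which bounds \<open>\<xi> i 1\<close> from below by 1.
\<close>
lemma xi_dichotomy:
  assumes j: "j \<in> I" "\<xi> j 1 = 1" and i: "i \<in> I"
  shows "\<xi> i 1 = 1"
proof (cases "i = j")
  case False
  have ij: "i \<in> I - {j}" using i False by simp
  have xi: "0 \<le> \<xi> i 1" "\<xi> i 1 \<le> 1" using xi_pos[OF i, of 1] xi_le_1[OF i, of 1] by auto
  have "ret_gf j 1 = 1 - \<alpha> j"
    using j ret_gf_less_1[OF j(1), of 1] by (simp add: \<xi>_def field_simps)
  then have s: "(\<Sum>k. ret j k) = 1 - \<alpha> j" by (simp add: ret_gf_def)
  \<comment> \<open>Excursions that start in the factor \<open>i\<close> return with probability at most \<open>\<xi> i 1\<close>.\<close>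
  have "(\<Sum>k. ret j k) \<le> 1 - \<alpha> j - \<alpha> i * (1 - \<xi> i 1)"
  proof (rule suminf_le_const[OF summable_ret[OF j(1)]])
    fix n
    have "(\<Sum>k<n. ret j k) \<le> (\<Sum>k\<le>n. ret j k)"
      by (rule sum_mono2) (auto simp: ret_nonneg)
    also have "\<dots> \<le> (\<Sum>l\<in>I - {j}. \<alpha> l * (if l = i then \<xi> i 1 else 1))"
      unfolding sum_ret
    proof (intro sum_mono mult_left_mono expect_le hit_by_bounds)
      fix l g assume "l \<in> I - {j}" "g \<in> set_pmf (\<mu> l)"
      then show "(\<Sum>k\<le>n. first_hit k [(l, g)]) \<le> (if l = i then \<xi> i 1 else 1)"
        using hit_by_le_xi[of l g n] hit_by_bounds(2)[of "[(l, g)]" n] mu_B[of l g]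
        by (cases "l = i") auto
    qed (use alpha_pos in \<open>auto intro: less_imp_le\<close>)
    also have "\<dots> = \<alpha> i * \<xi> i 1 + (\<Sum>l\<in>I - {j} - {i}. \<alpha> l)"
      by (subst sum.remove[OF _ ij]) (use fin in \<open>auto intro: sum.cong\<close>)
    also have "(\<Sum>l\<in>I - {j} - {i}. \<alpha> l) = 1 - \<alpha> j - \<alpha> i"
      using sum.remove[OF _ ij, of \<alpha>] alpha_others[OF j(1)] fin by simp
    finally show "(\<Sum>k<n. ret j k) \<le> 1 - \<alpha> j - \<alpha> i * (1 - \<xi> i 1)"
      by (simp add: algebra_simps)
  qed
  then have "\<alpha> i * (1 - \<xi> i 1) \<le> 0" using s by simp
  then show ?thesis using alpha_pos[OF i] xi by (simp add: mult_le_0_iff)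
qed (use j in simp)

text \<open>
  The first block of the prefix costs a factor \<open>\<xi> i 1\<close>. After a step by a block \<open>g\<close> of the same
  factor, either \<open>g\<close> is the prescribed block \<open>h\<close> and the remaining walk must begin with the rest of
  the prefix, or the remaining walk must begin with the same prefix with \<open>h\<close> replaced by
  \<open>inv g \<otimes> h\<close>. The second case is why the inner induction on time treats all \<open>h\<close> at once.
\<close>
lemma prob_prefix_le:
  assumes "set u \<subseteq> B"
  shows "measure_pmf.prob (walk n []) {y. take (length u) y = u} \<le> (\<Prod>a\<leftarrow>u. \<xi> (fst a) 1)"
  using assms
proof (induction u arbitrary: n)
  case (Cons a u)
  obtain i h where a: "a = (i, h)" by fastforce
  define t where "t = (\<Prod>a\<leftarrow>u. \<xi> (fst a) 1)"
  have xi_I: "0 < \<xi> (fst a) 1 \<and> \<xi> (fst a) 1 \<le> 1" if "a \<in> B" for a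
    using that xi_pos[of "fst a" 1] xi_le_1[of "fst a" 1] by (auto simp: blocks_def)
  have t: "0 \<le> t" unfolding t_def
    using Cons.prems xi_I by (intro prod_list_nonneg) (auto intro: less_imp_le)
  let ?Q = "\<lambda>h. {y. take (length (a # u)) y = (i, h) # u}"
  have i: "i \<in> I" using Cons.prems by (auto simp: a blocks_def)
  interpret Gi: group "G i" by (rule grp[OF i])
  have "measure_pmf.prob (walk n []) (?Q h) \<le> \<xi> i 1 * t" if "(i, h) \<in> B" for h
    using that
  proof (induction n arbitrary: h rule: less_induct)
    case (less n)
    have h: "h \<in> carrier (G i)" using less.prems by (auto simp: blocks_def)
    have c: "caloric_off i [] (\<lambda>n w. measure_pmf.prob (walk n w) (?Q h))"
    proof (rule caloric_off_prob)
      show "[] \<star> y \<notin> ?Q h" if "y \<in> off i" for y using that by (cases y) auto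
    qed
    show ?case
    proof (rule caloric_off_le[OF i c _ t])
      fix m g assume m: "m < n" and g: "g \<in> set_pmf (\<mu> i)"
      have gB: "(i, g) \<in> B" using mu_B i g by blast
      then have gc: "g \<in> carrier (G i)" by (auto simp: blocks_def)
      have "measure_pmf.prob (walk m ([] \<star> [(i, g)])) (?Q h) =
          measure_pmf.prob (walk m []) ((\<star>) [(i, g)] -` ?Q h)"
        using gB by (subst walk_from[of "[] \<star> [(i, g)]"]) auto
      also have "\<dots> \<le> t"
      proof (cases "g = h")
        case True
        have "measure_pmf.prob (walk m []) ((\<star>) [(i, g)] -` ?Q h) \<le>
            measure_pmf.prob (walk m []) {y. take (length u) y = u}"
        proof (rule measure_pmf.finite_measure_mono_AE)
          show "AE y in walk m []. y \<in> (\<star>) [(i, g)] -` ?Q h \<longrightarrow> y \<in> {y. take (length u) y = u}"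
            unfolding AE_measure_pmf_iff
          proof (intro ballI impI)
            fix y assume "y \<in> set_pmf (walk m [])" and Q: "y \<in> (\<star>) [(i, g)] -` ?Q h"
            then have yW: "y \<in> W" using walk_W[of "[]" y m] by simp
            show "y \<in> {y. take (length u) y = u}" using gB yW
            proof (cases rule: block_mult_cases)
              case off
              then show ?thesis using Q by simp
            next
              case (cancel k v)
              then have "v = (i, h) # tl v" using Q by (cases v) auto
              then show ?thesis using cancel(4) by (metis Cons_off fst_conv)
            next
              case (merge k v)
              have k: "k \<in> carrier (G i)" "k \<noteq> \<one>\<^bsub>G i\<^esub>" using merge(2) by (auto simp: blocks_def)
              have "g \<otimes>\<^bsub>G i\<^esub> k = g" using Q merge(6) True by simp
              then show ?thesis using gc k by simp
            qed
          qed
        qed simp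
        also have "\<dots> \<le> t" unfolding t_def by (rule Cons.IH) (use Cons.prems in auto)
        finally show ?thesis .
      next
        case False
        let ?h = "inv\<^bsub>G i\<^esub> g \<otimes>\<^bsub>G i\<^esub> h"
        have "?h \<noteq> \<one>\<^bsub>G i\<^esub>" using False gc h
          by (metis Gi.inv_closed Gi.inv_equality Gi.inv_inv)
        then have hB: "(i, ?h) \<in> B" using i gc h by (auto simp: blocks_def)
        have "measure_pmf.prob (walk m []) ((\<star>) [(i, g)] -` ?Q h) \<le>
            measure_pmf.prob (walk m []) (?Q ?h)"
        proof (rule measure_pmf.finite_measure_mono_AE)
          show "AE y in walk m []. y \<in> (\<star>) [(i, g)] -` ?Q h \<longrightarrow> y \<in> ?Q ?h"
            unfolding AE_measure_pmf_iff
          proof (intro ballI impI)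
            fix y assume "y \<in> set_pmf (walk m [])" and Q: "y \<in> (\<star>) [(i, g)] -` ?Q h"
            then have yW: "y \<in> W" using walk_W[of "[]" y m] by simp
            show "y \<in> ?Q ?h" using gB yW
            proof (cases rule: block_mult_cases)
              case off
              then show ?thesis using Q False by simp
            next
              case (cancel k v)
              then have "v = (i, h) # tl v" using Q by (cases v) auto
              then show ?thesis using cancel(4) by (metis Cons_off fst_conv)
            next
              case (merge k v)
              have k: "k \<in> carrier (G i)" using merge(2) by (auto simp: blocks_def)
              have "g \<otimes>\<^bsub>G i\<^esub> k = h" using Q merge(6) by simp
              then have "k = ?h" using gc k h Gi.inv_solve_left by metis
              then show ?thesis using Q merge(1,6) by simp
            qed
          qed
        qed simp
        also have "\<dots> \<le> \<xi> i 1 * t" by (rule less.IH[OF m hB])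
        also have "\<dots> \<le> t" using t xi_le_1[OF i, of 1] by (simp add: mult_left_le_one_le xi_pos[OF i, THEN less_imp_le])
        finally show ?thesis .
      qed
      finally show "measure_pmf.prob (walk m ([] \<star> [(i, g)])) (?Q h) \<le> t" .
    qed simp
  qed
  from this[of h] show ?case using Cons.prems by (simp add: a t_def)
qed simp


text \<open>
  The renewal equation is a convolution, so it becomes linear for generating functions:
  \<open>Q = \<alpha> i * z * E + ret_gf i z * Q\<close>.
\<close>
lemma caloric_off_gf:
  assumes i: "i \<in> I" and q: "caloric_off i x q" and x: "x \<in> W" and z: "0 < z" "z < 1"
  shows "(\<Sum>n. q n x * z ^ n) = \<xi> i z * expect (\<mu> i) (\<lambda>g. \<Sum>n. q n (x \<star> [(i, g)]) * z ^ n)"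
proof -
  define e where "e = (\<lambda>n. expect (\<mu> i) (\<lambda>g. q n (x \<star> [(i, g)])))"
  define E where "E = expect (\<mu> i) (\<lambda>g. \<Sum>n. q n (x \<star> [(i, g)]) * z ^ n)"
  define Q where "Q = (\<Sum>n. q n x * z ^ n)"
  have qa: "\<bar>q n (x \<star> [(i, g)])\<bar> \<le> 1" if "g \<in> set_pmf (\<mu> i)" for n g
    using caloric_off_bounds(3)[OF q] x mu_B[OF i that] by simp
  have E: "(\<Sum>n. e n * z ^ n) = E" "summable (\<lambda>n. e n * z ^ n)"
    unfolding e_def E_def using suminf_expect(1,2)[of "\<mu> i" "\<lambda>n g. q n (x \<star> [(i, g)])" 1 z, OF qa] z
    by auto
  have sQ: "summable (\<lambda>n. \<bar>q n x * z ^ n\<bar>)"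
    by (rule summable_comparison_test[OF _ summable_geometric[of z]])
       (use z caloric_off_bounds(3)[OF q x] in \<open>auto simp: abs_mult mult_left_le_one_le\<close>)
  have sQ': "summable (\<lambda>n. q n x * z ^ n)" by (rule summable_rabs_cancel[OF sQ])
  have sR: "summable (\<lambda>k. ret i k * z ^ k)" using summable_ret_power i z by simp
  have sR': "summable (\<lambda>k. \<bar>ret i k * z ^ k\<bar>)" using sR ret_nonneg z by simp
  have C: "(\<lambda>n. \<Sum>k\<le>n. (ret i k * z ^ k) * (q (n - k) x * z ^ (n - k))) sums
      ((\<Sum>k. ret i k * z ^ k) * Q)"
    unfolding Q_def using Cauchy_product_sums[of "\<lambda>k. ret i k * z ^ k" "\<lambda>n. q n x * z ^ n"] sQ sR'
    by simp
  have "q (Suc n) x * z ^ Suc n = \<alpha> i * z * (e n * z ^ n) +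
      z * (\<Sum>k\<le>n. (ret i k * z ^ k) * (q (n - k) x * z ^ (n - k)))" for n
  proof -
    have "(\<Sum>k\<le>n. (ret i k * z ^ k) * (q (n - k) x * z ^ (n - k))) =
        (\<Sum>k\<le>n. ret i k * q (n - k) x * z ^ n)"
      by (intro sum.cong refl) (simp add: power_add[symmetric] mult_ac)
    then show ?thesis
      unfolding caloric_off_Suc[OF i q x] e_def
      by (simp add: sum_distrib_left sum_distrib_right algebra_simps)
  qed
  moreover have "(\<lambda>n. \<alpha> i * z * (e n * z ^ n) +
      z * (\<Sum>k\<le>n. (ret i k * z ^ k) * (q (n - k) x * z ^ (n - k)))) sums
      (\<alpha> i * z * E + z * ((\<Sum>k. ret i k * z ^ k) * Q))"
    using E by (intro sums_add sums_mult C) (auto simp: summable_sums)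
  ultimately have "(\<lambda>n. q (Suc n) x * z ^ Suc n) sums (\<alpha> i * z * E + ret_gf i z * Q)"
    using ret_gf_factor[OF i, of z] z by (simp add: mult_ac)
  moreover have "q 0 x = 0" using q x by (auto simp: caloric_off_def dest!: bspec[of _ _ "[]"])
  then have "(\<lambda>n. q (Suc n) x * z ^ Suc n) sums Q"
    using summable_sums[OF sQ'] unfolding Q_def by (subst sums_Suc_iff) simp
  ultimately have "Q = \<alpha> i * z * E + ret_gf i z * Q" by (metis sums_unique2)
  then have "Q * (1 - ret_gf i z) = \<alpha> i * z * E" by (simp add: algebra_simps)
  then show ?thesis
    using ret_gf_less_1[OF i, of z] z unfolding Q_def[symmetric] E_def[symmetric] \<xi>_def
    by (simp add: field_simps)
qed


section \<open>The mean length\<close>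

abbreviation Green :: "nat \<Rightarrow> real \<Rightarrow> real" where
  "Green i \<equiv> green (carrier (G i)) (group_trans (G i) (\<mu> i)) \<one>\<^bsub>G i\<^esub> \<one>\<^bsub>G i\<^esub>"

definition p_off :: "nat \<Rightarrow> nat \<Rightarrow> (nat \<times> 'a) list \<Rightarrow> real" where
  "p_off i n x = measure_pmf.prob (walk n x) (off i)"

lemma p_off_abs: "\<bar>p_off i n x\<bar> \<le> 1"
  by (simp add: p_off_def)

lemma p_off_summable:
  assumes "0 < z" "z < 1"
  shows "summable (\<lambda>n. p_off i n x * z ^ n)"
  by (rule summable_comparison_test[OF _ summable_geometric[of z]])
     (use assms in \<open>auto simp: p_off_def mult_left_le_one_le\<close>)

lemma embed_W: "i \<in> I \<Longrightarrow> h \<in> carrier (G i) \<Longrightarrow> embed G i h \<in> W"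
  by (auto simp: embed_def blocks_def)

lemma embed_star_block:
  assumes "(i, g) \<in> B" "h \<in> carrier (G i)"
  shows "embed G i h \<star> [(i, g)] = embed G i (h \<otimes>\<^bsub>G i\<^esub> g)"
proof -
  interpret Gi: group "G i" using grp assms by (auto simp: blocks_def)
  show ?thesis using assms by (auto simp: embed_def blocks_def)
qed

text \<open>
  On the factor \<open>i\<close>, the generating function \<open>V\<close> of the probability of being in \<open>off i\<close> satisfies
  a first-step equation for the walk of \<open>\<mu> i\<close> killed with weight \<open>\<xi> i z\<close>. Away from the identity,
  this is \<open>caloric_off_gf\<close> for the set \<open>off i\<close>; at the identity, where the walk already is in
  \<open>off i\<close>, it is applied to the complement, which produces the source term.
\<close>
lemma p_off_gf:
  assumes i: "i \<in> I" and z: "0 < z" "z < 1"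
  shows "(\<Sum>n. p_off i n [] * z ^ n) = (1 - \<xi> i z) / (1 - z) * Green i (\<xi> i z)"
    and "(\<Sum>n. p_off i n [] * z ^ n) =
      (1 - \<xi> i z) / (1 - z) + \<xi> i z * expect (\<mu> i) (\<lambda>g. \<Sum>n. p_off i n [(i, g)] * z ^ n)"
proof -
  interpret Gi: group "G i" by (rule grp[OF i])
  define V where "V = (\<lambda>h. \<Sum>n. p_off i n (embed G i h) * z ^ n)"
  have s: "summable (\<lambda>n. p_off i n x * z ^ n)" for x by (rule p_off_summable[OF z])
  have gz: "(\<Sum>n. z ^ n) = 1 / (1 - z)" using z by (simp add: suminf_geometric)
  have V01: "0 \<le> V h" "V h \<le> 1 / (1 - z)" for h
  proof -
    show "0 \<le> V h" unfolding V_def by (rule suminf_nonneg[OF s]) (use z in \<open>simp add: p_off_def\<close>)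
    show "V h \<le> 1 / (1 - z)" unfolding V_def gz[symmetric]
      by (intro suminf_le s summable_geometric) (use z in \<open>auto simp: p_off_def mult_left_le_one_le\<close>)
  qed
  have Vabs: "\<bar>V h\<bar> \<le> 1 / (1 - z)" for h using V01[of h] by simp
  have one: "embed G i \<one>\<^bsub>G i\<^esub> = []" by (simp add: embed_def)
  have V1: "V \<one>\<^bsub>G i\<^esub> = (1 - \<xi> i z) / (1 - z) + \<xi> i z * expect (\<mu> i) (\<lambda>g. V g)"
  proof -
    have c: "caloric_off i [] (\<lambda>n w. measure_pmf.prob (walk n w) (- off i))"
      by (rule caloric_off_prob) simp
    have compl: "measure_pmf.prob (walk n w) (- off i) = 1 - p_off i n w" for n w
      using measure_pmf.prob_compl[of "off i" "walk n w"] by (simp add: p_off_def Compl_eq_Diff_UNIV)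
    have e: "(\<Sum>n. (1 - p_off i n w) * z ^ n) = 1 / (1 - z) - (\<Sum>n. p_off i n w * z ^ n)" for w
      using z by (subst gz[symmetric], subst suminf_diff[OF summable_geometric s]) (auto simp: algebra_simps)
    have "1 / (1 - z) - V \<one>\<^bsub>G i\<^esub> =
        \<xi> i z * expect (\<mu> i) (\<lambda>g. 1 / (1 - z) - (\<Sum>n. p_off i n ([] \<star> [(i, g)]) * z ^ n))"
      using caloric_off_gf[OF i c _ z] by (simp add: compl e V_def one)
    also have "expect (\<mu> i) (\<lambda>g. 1 / (1 - z) - (\<Sum>n. p_off i n ([] \<star> [(i, g)]) * z ^ n)) =
        expect (\<mu> i) (\<lambda>g. 1 / (1 - z) - V g)"
      using mu_B[OF i] by (intro expect_cong) (auto simp: V_def embed_def blocks_def)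
    also have "\<dots> = 1 / (1 - z) - expect (\<mu> i) V"
      using Vabs by (subst expect_diff[where c = "1 / (1 - z)" and d = "1 / (1 - z)"]) (use z in auto)
    finally show ?thesis using z by (simp add: field_simps)
  qed
  have Vh: "V h = \<xi> i z * expect (\<mu> i) (\<lambda>g. V (h \<otimes>\<^bsub>G i\<^esub> g))"
    if h: "h \<in> carrier (G i)" "h \<noteq> \<one>\<^bsub>G i\<^esub>" for h
  proof -
    have c: "caloric_off i (embed G i h) (\<lambda>n w. measure_pmf.prob (walk n w) (off i))"
      by (rule caloric_off_prob) (use h in \<open>simp add: embed_def mult_block_off\<close>)
    have "V h = \<xi> i z * expect (\<mu> i) (\<lambda>g. \<Sum>n. p_off i n (embed G i h \<star> [(i, g)]) * z ^ n)"
      using caloric_off_gf[OF i c embed_W[OF i h(1)] z] by (simp add: V_def p_off_def)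
    also have "expect (\<mu> i) (\<lambda>g. \<Sum>n. p_off i n (embed G i h \<star> [(i, g)]) * z ^ n) =
        expect (\<mu> i) (\<lambda>g. V (h \<otimes>\<^bsub>G i\<^esub> g))"
      using mu_B[OF i] h(1) by (intro expect_cong) (simp add: V_def embed_star_block)
    finally show ?thesis .
  qed
  have supp': "set_pmf (\<mu> i) \<subseteq> carrier (G i)" using supp[OF i] by blast
  have "V \<one>\<^bsub>G i\<^esub> = (1 - \<xi> i z) / (1 - z) * Green i (\<xi> i z)"
  proof (rule green_unique[OF Gi.is_group supp' Gi.one_closed, where c = "1 / (1 - z)"])
    fix h assume h: "h \<in> carrier (G i)"
    have "expect (\<mu> i) (\<lambda>g. V g) = expect (\<mu> i) (\<lambda>g. V (\<one>\<^bsub>G i\<^esub> \<otimes>\<^bsub>G i\<^esub> g))"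
      using supp' by (intro expect_cong) auto
    then show "V h = (1 - \<xi> i z) / (1 - z) * of_bool (h = \<one>\<^bsub>G i\<^esub>) +
        \<xi> i z * expect (\<mu> i) (\<lambda>g. V (h \<otimes>\<^bsub>G i\<^esub> g))"
      using V1 Vh[OF h] by (cases "h = \<one>\<^bsub>G i\<^esub>") auto
  qed (use Vabs xi_pos[OF i z(1)] xi_less_1[OF i _ z(2)] z in auto)
  then show "(\<Sum>n. p_off i n [] * z ^ n) = (1 - \<xi> i z) / (1 - z) * Green i (\<xi> i z)"
    by (simp add: V_def one)
  have "expect (\<mu> i) V = expect (\<mu> i) (\<lambda>g. \<Sum>n. p_off i n [(i, g)] * z ^ n)"
    using supp[OF i] by (intro expect_cong) (auto simp: V_def embed_def)
  then show "(\<Sum>n. p_off i n [] * z ^ n) =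
      (1 - \<xi> i z) / (1 - z) + \<xi> i z * expect (\<mu> i) (\<lambda>g. \<Sum>n. p_off i n [(i, g)] * z ^ n)"
    using V1 by (simp add: V_def one)
qed

definition rate_term :: "nat \<Rightarrow> real \<Rightarrow> real" where
  "rate_term i t = (1 - t) / t * (1 - (1 - t) * Green i t)"

text \<open>
  The expected change of length when \<open>Z\<^sub>n\<close> is multiplied on the left by a block drawn from \<open>\<mu> i\<close>.
\<close>
definition drift :: "nat \<Rightarrow> nat \<Rightarrow> real" where
  "drift i n = p_off i n [] - expect (\<mu> i) (\<lambda>g. p_off i n [(i, g)])"

lemma drift_gf:
  assumes i: "i \<in> I" and z: "0 < z" "z < 1"
  shows "(1 - z) * (\<Sum>n. drift i n * z ^ n) = rate_term i (\<xi> i z)"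
    and "summable (\<lambda>n. drift i n * z ^ n)"
proof -
  define b where "b = (\<Sum>n. p_off i n [] * z ^ n)"
  define E where "E = expect (\<mu> i) (\<lambda>g. \<Sum>n. p_off i n [(i, g)] * z ^ n)"
  note ex = suminf_expect[of "\<mu> i" "\<lambda>n g. p_off i n [(i, g)]" 1 z, OF p_off_abs]
  have s1: "summable (\<lambda>n. p_off i n [] * z ^ n)" by (rule p_off_summable[OF z])
  have s2: "summable (\<lambda>n. expect (\<mu> i) (\<lambda>g. p_off i n [(i, g)]) * z ^ n)" using ex(2) z by simp
  show "summable (\<lambda>n. drift i n * z ^ n)"
    using summable_diff[OF s1 s2] by (simp add: drift_def algebra_simps)
  have d: "(\<Sum>n. drift i n * z ^ n) = b - E"
    using suminf_diff[OF s1 s2] ex(1) z by (simp add: drift_def b_def E_def algebra_simps)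
  have xi: "0 < \<xi> i z" using xi_pos[OF i z(1)] z by simp
  have "\<xi> i z * ((1 - z) * (b - E)) = (1 - z) * (\<xi> i z * b - (b - (1 - \<xi> i z) / (1 - z)))"
    using p_off_gf(2)[OF i z] by (simp add: b_def E_def algebra_simps)
  also have "\<dots> = (1 - \<xi> i z) - (1 - \<xi> i z) * ((1 - z) * b)"
    using z by (simp add: field_simps)
  also have "(1 - z) * b = (1 - \<xi> i z) * Green i (\<xi> i z)"
    unfolding b_def p_off_gf(1)[OF i z] using z by simp
  finally show "(1 - z) * (\<Sum>n. drift i n * z ^ n) = rate_term i (\<xi> i z)"
    unfolding d rate_term_def using xi by (simp add: field_simps)
qed

definition mean :: "nat \<Rightarrow> real" where
  "mean n = expect (walk n []) (\<lambda>y. real (length y))"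

lemma expect_walk_from:
  assumes "x \<in> W"
  shows "expect (walk n x) f = expect (walk n []) (\<lambda>y. f (x \<star> y))"
  by (subst walk_from[OF assms]) simp

lemma walk_length_abs:
  assumes "x \<in> W" "y \<in> set_pmf (walk n x)"
  shows "\<bar>real (length y)\<bar> \<le> real (length x) + real n"
  using walk_length[OF assms] by linarith

lemma mean_upper:
  assumes x: "x \<in> W"
  shows "expect (walk n x) (\<lambda>y. real (length y)) \<le> real (length x) + mean n"
proof -
  have "expect (walk n x) (\<lambda>y. real (length y)) = expect (walk n []) (\<lambda>y. real (length (x \<star> y)))"
    by (rule expect_walk_from[OF x])
  also have "\<dots> \<le> expect (walk n []) (\<lambda>y. real (length x) + real (length y))"
  proof (rule expect_mono[where c = "real (length x) + real n" and d = "real (length x) + real n"])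
    fix y assume y: "y \<in> set_pmf (walk n [])"
    have 1: "real (length (x \<star> y)) \<le> real (length x) + real (length y)"
      using length_star[of x y] by linarith
    then show "real (length (x \<star> y)) \<le> real (length x) + real (length y)" .
    show "\<bar>real (length (x \<star> y))\<bar> \<le> real (length x) + real n"
      using 1 walk_length_Nil[OF y] by linarith
    show "\<bar>real (length x) + real (length y)\<bar> \<le> real (length x) + real n"
      using walk_length_Nil[OF y] by linarith
  qed
  also have "\<dots> = real (length x) + mean n"
    unfolding mean_def
    by (subst expect_add[where c = "real (length x)" and d = "real n"])
       (use walk_length_Nil in auto)
  finally show ?thesis .
qed

lemma mean_bounds: "0 \<le> mean n" "mean n \<le> real n"
  unfolding mean_def using walk_length_Nil by (auto intro!: expect_nonneg expect_le)

lemma mean_0: "mean 0 = 0"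
  by (simp add: mean_def)

lemma mean_subadditive: "mean (m + n) \<le> mean m + mean n"
proof -
  have "mean (m + n) = expect (walk m []) (\<lambda>x. expect (walk n x) (\<lambda>y. real (length y)))"
    unfolding mean_def walk_add
  proof (rule expect_bind_pmf[where c = "real m + real n"])
    fix x y assume x: "x \<in> set_pmf (walk m [])" and y: "y \<in> set_pmf (walk n x)"
    show "\<bar>real (length y)\<bar> \<le> real m + real n"
      using walk_length_abs[OF _ y] walk_W[of "[]" x m] walk_length_Nil[OF x] x by auto
  qed
  also have "\<dots> \<le> expect (walk m []) (\<lambda>x. real (length x) + mean n)"
  proof (rule expect_mono[where c = "real m + real n" and d = "real m + real n"])
    fix x assume x: "x \<in> set_pmf (walk m [])"
    then have xW: "x \<in> W" using walk_W[of "[]" x m] by simp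
    show "expect (walk n x) (\<lambda>y. real (length y)) \<le> real (length x) + mean n"
      by (rule mean_upper[OF xW])
    show "\<bar>expect (walk n x) (\<lambda>y. real (length y))\<bar> \<le> real m + real n"
      using walk_length_abs[OF xW] walk_length_Nil[OF x] by (intro expect_abs_le) force
    show "\<bar>real (length x) + mean n\<bar> \<le> real m + real n"
      using mean_bounds[of n] walk_length_Nil[OF x] by simp
  qed
  also have "\<dots> = mean m + mean n"
    unfolding mean_def[of m]
    by (subst expect_add[where c = "real m" and d = "\<bar>mean n\<bar>"]) (use walk_length_Nil in auto)
  finally show ?thesis .
qed

lemma mean_linear_upper:
  assumes "0 < m"
  shows "mean n \<le> mean m / real m * real n + real m"
proof (induction n rule: less_induct)
  case (less n)
  show ?case
  proof (cases "n < m")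
    case True
    have "0 \<le> mean m / real m * real n" using mean_bounds[of m] by simp
    then show ?thesis using mean_bounds(2)[of n] True by linarith
  next
    case False
    have "mean n \<le> mean m + mean (n - m)" using mean_subadditive[of m "n - m"] False by simp
    also have "\<dots> \<le> mean m + (mean m / real m * real (n - m) + real m)"
      using less.IH[of "n - m"] assms False by simp
    also have "\<dots> = mean m / real m * real n + real m"
      using assms False by (simp add: of_nat_diff field_simps)
    finally show ?thesis .
  qed
qed

lemma length_mult_block_off:
  assumes "(i, g) \<in> B" "y \<in> W"
  shows "real (length ([(i, g)] \<star> y)) =
    real (length y) + (indicator (off i) y - indicator (off i) ([(i, g)] \<star> y))"
  using assms by (cases rule: block_mult_cases) auto

lemma mean_Suc: "mean (Suc n) - mean n = (\<Sum>i\<in>I. \<alpha> i * drift i n)"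
proof -
  have "mean (Suc n) = expect step (\<lambda>s. expect (walk n ([] \<star> s)) (\<lambda>y. real (length y)))"
    unfolding mean_def walk.simps
  proof (rule expect_bind_pmf[where c = "real (Suc n)"])
    fix s y assume "s \<in> set_pmf step" "y \<in> set_pmf (walk n ([] \<star> s))"
    then have "y \<in> set_pmf (walk (Suc n) [])" by auto
    from walk_length_Nil[OF this] show "\<bar>real (length y)\<bar> \<le> real (Suc n)" by simp
  qed
  also have "\<dots> = (\<Sum>i\<in>I. \<alpha> i * expect (\<mu> i) (\<lambda>g. expect (walk n ([] \<star> [(i, g)])) (\<lambda>y. real (length y))))"
  proof (rule expect_step[where c = "real (Suc n)"], rule expect_abs_le)
    fix i g y assume ig: "i \<in> I" "g \<in> set_pmf (\<mu> i)" and "y \<in> set_pmf (walk n ([] \<star> [(i, g)]))"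
    then have "y \<in> set_pmf (walk (Suc n) [])" by (auto simp: step_def set_index)
    from walk_length_Nil[OF this] show "\<bar>real (length y)\<bar> \<le> real (Suc n)" by simp
  qed
  also have "\<dots> = (\<Sum>i\<in>I. \<alpha> i * (mean n + drift i n))"
  proof (intro sum.cong refl arg_cong2[where f = "(*)"])
    fix i assume i: "i \<in> I"
    have "expect (walk n ([] \<star> [(i, g)])) (\<lambda>y. real (length y)) =
        mean n + (p_off i n [] - p_off i n [(i, g)])" if g: "g \<in> set_pmf (\<mu> i)" for g
    proof -
      note gB = mu_B[OF i g]
      have "expect (walk n ([] \<star> [(i, g)])) (\<lambda>y. real (length y)) =
          expect (walk n []) (\<lambda>y. real (length ([(i, g)] \<star> y)))"
        using expect_walk_from[of "[(i, g)]"] gB by simp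
      also have "\<dots> = expect (walk n []) (\<lambda>y. real (length y) +
          (indicator (off i) y - indicator (off i) ([(i, g)] \<star> y)))"
        using walk_W[of "[]" _ n] by (intro expect_cong length_mult_block_off[OF gB]) simp
      also have "\<dots> = mean n + expect (walk n []) (\<lambda>y. indicator (off i) y - indicator (off i) ([(i, g)] \<star> y))"
        unfolding mean_def
        by (rule expect_add[where c = "real n" and d = 1])
           (use walk_length_Nil in \<open>auto simp: indicator_def\<close>)
      also have "expect (walk n []) (\<lambda>y. indicator (off i) y - indicator (off i) ([(i, g)] \<star> y)) =
          expect (walk n []) (indicator (off i)) - expect (walk n []) (\<lambda>y. indicator (off i) ([(i, g)] \<star> y))"
        by (rule expect_diff[where c = 1 and d = 1]) (auto simp: indicator_def)
      also have "expect (walk n []) (\<lambda>y. indicator (off i) ([(i, g)] \<star> y)) =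
          expect (walk n [(i, g)]) (indicator (off i))"
        using expect_walk_from[of "[(i, g)]" n "indicator (off i)"] gB by simp
      finally show ?thesis by (simp add: p_off_def)
    qed
    then have "expect (\<mu> i) (\<lambda>g. expect (walk n ([] \<star> [(i, g)])) (\<lambda>y. real (length y))) =
        expect (\<mu> i) (\<lambda>g. mean n + (p_off i n [] - p_off i n [(i, g)]))"
      by (rule expect_cong)
    also have "\<dots> = mean n + drift i n"
    proof -
      have "\<bar>p_off i n [] - p_off i n [(i, g)]\<bar> \<le> 2" for g
        using p_off_abs[of i n "[]"] p_off_abs[of i n "[(i, g)]"] by linarith
      moreover have "expect (\<mu> i) (\<lambda>g. p_off i n [] - p_off i n [(i, g)]) = drift i n"
        unfolding drift_def by (subst expect_diff[where c = 1 and d = 1]) (simp_all add: p_off_abs)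
      ultimately show ?thesis
        by (subst expect_add[where c = "\<bar>mean n\<bar>" and d = 2]) auto
    qed
    finally show "expect (\<mu> i) (\<lambda>g. expect (walk n ([] \<star> [(i, g)])) (\<lambda>y. real (length y))) =
        mean n + drift i n" .
  qed
  also have "\<dots> = (\<Sum>i\<in>I. \<alpha> i) * mean n + (\<Sum>i\<in>I. \<alpha> i * drift i n)"
    by (simp add: distrib_left sum.distrib sum_distrib_right)
  finally show ?thesis by (simp add: alpha_sum)
qed

definition speed :: real where
  "speed = (\<Sum>i\<in>I. \<alpha> i * rate_term i (\<xi> i 1))"

lemma mean_gf:
  assumes z: "0 < z" "z < 1"
  shows "(1 - z)\<^sup>2 * (\<Sum>n. mean (Suc n) * z ^ n) = (\<Sum>i\<in>I. \<alpha> i * rate_term i (\<xi> i z))"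
    and "summable (\<lambda>n. mean (Suc n) * z ^ n)"
proof -
  have sg: "summable (\<lambda>n. real (Suc n) * z ^ n)"
    using geometric_deriv_sums[of z] z by (auto simp: sums_iff)
  show s: "summable (\<lambda>n. mean (Suc n) * z ^ n)"
    by (rule summable_comparison_test[OF _ sg])
       (use mean_bounds z in \<open>auto simp: abs_mult intro!: mult_right_mono simp del: of_nat_Suc\<close>)
  have s0: "summable (\<lambda>n. mean n * z ^ n)"
  proof (subst summable_Suc_iff[symmetric])
    show "summable (\<lambda>n. mean (Suc n) * z ^ Suc n)"
      using summable_mult[OF s, of z] by (simp add: mult_ac)
  qed
  have "(\<Sum>n. mean n * z ^ n) = (\<Sum>n. mean (Suc n) * z ^ Suc n)"
    using suminf_split_head[OF s0] by (simp add: mean_0)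
  also have "\<dots> = z * (\<Sum>n. mean (Suc n) * z ^ n)"
    by (subst suminf_mult[OF s, symmetric]) (simp add: mult_ac)
  finally have "(1 - z) * (\<Sum>n. mean (Suc n) * z ^ n) =
      (\<Sum>n. mean (Suc n) * z ^ n) - (\<Sum>n. mean n * z ^ n)" by (simp add: algebra_simps)
  also have "\<dots> = (\<Sum>n. (mean (Suc n) - mean n) * z ^ n)"
    using suminf_diff[OF s s0] by (simp add: algebra_simps)
  also have "\<dots> = (\<Sum>n. \<Sum>i\<in>I. \<alpha> i * (drift i n * z ^ n))"
    by (simp add: mean_Suc sum_distrib_right mult.assoc)
  also have "\<dots> = (\<Sum>i\<in>I. \<Sum>n. \<alpha> i * (drift i n * z ^ n))"
    by (rule suminf_sum) (use drift_gf(2) z in \<open>auto intro: summable_mult\<close>)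
  also have "\<dots> = (\<Sum>i\<in>I. \<alpha> i * (\<Sum>n. drift i n * z ^ n))"
    by (intro sum.cong refl suminf_mult drift_gf(2)) (use z in auto)
  finally have "(1 - z)\<^sup>2 * (\<Sum>n. mean (Suc n) * z ^ n) =
      (1 - z) * (\<Sum>i\<in>I. \<alpha> i * (\<Sum>n. drift i n * z ^ n))" by (simp add: power2_eq_square)
  also have "\<dots> = (\<Sum>i\<in>I. \<alpha> i * ((1 - z) * (\<Sum>n. drift i n * z ^ n)))"
    by (simp add: sum_distrib_left mult_ac)
  also have "\<dots> = (\<Sum>i\<in>I. \<alpha> i * rate_term i (\<xi> i z))"
    using drift_gf(1) z by (intro sum.cong) auto
  finally show "(1 - z)\<^sup>2 * (\<Sum>n. mean (Suc n) * z ^ n) = (\<Sum>i\<in>I. \<alpha> i * rate_term i (\<xi> i z))" .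
qed

text \<open>The coefficients \<open>ret i\<close> are summable, so the power series is continuous up to the boundary.\<close>
lemma xi_tendsto:
  assumes i: "i \<in> I"
  shows "(\<xi> i \<longlongrightarrow> \<xi> i 1) (at_left 1)"
proof -
  have ul: "uniform_limit {0..1} (\<lambda>n z. \<Sum>k<n. ret i k * z ^ k) (\<lambda>z. \<Sum>k. ret i k * z ^ k) sequentially"
    by (rule Weierstrass_m_test[OF _ summable_ret[OF i]])
       (use ret_nonneg in \<open>auto simp: abs_mult mult_left_le power_le_one\<close>)
  have "continuous_on {0..1} (\<lambda>z. \<Sum>k. ret i k * z ^ k)"
    by (rule uniform_limit_theorem[OF _ ul]) (auto intro!: continuous_intros always_eventually)
  then have "continuous (at 1 within {0..1}) (\<lambda>z. \<Sum>k. ret i k * z ^ k)"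
    by (simp add: continuous_on_eq_continuous_within)
  moreover have "at 1 within {0..1} = at_left (1 :: real)"
    by (rule at_within_Icc_at_left) simp
  ultimately have "((\<lambda>z. \<Sum>k. ret i k * z ^ k) \<longlongrightarrow> (\<Sum>k. ret i k * 1 ^ k)) (at_left 1)"
    by (simp add: continuous_within)
  then have "((\<lambda>z. \<alpha> i * z / (1 - z * (\<Sum>k. ret i k * z ^ k))) \<longlongrightarrow>
      \<alpha> i * 1 / (1 - 1 * (\<Sum>k. ret i k * 1 ^ k))) (at_left 1)"
    using ret_gf_less_1[OF i, of 1] by (intro tendsto_intros) (auto simp: ret_gf_def)
  moreover have "eventually (\<lambda>z. \<alpha> i * z / (1 - z * (\<Sum>k. ret i k * z ^ k)) = \<xi> i z) (at_left 1)"
    using eventually_at_left_real[of 0 1, OF zero_less_one]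
    by eventually_elim (simp_all add: \<xi>_def ret_gf_factor[OF i])
  ultimately show ?thesis
    by (simp add: \<xi>_def[of i 1] ret_gf_def Lim_transform_eventually)
qed

text \<open>
  If \<open>\<xi> i 1 = 1\<close>, the Green function may diverge, but \<open>(1 - t) * Green i t\<close> stays between 0 and 1,
  so the factor \<open>1 - t\<close> forces the limit 0. This is the value of \<open>rate_term\<close> at 1 whatever the
  value given to the divergent series.
\<close>
lemma rate_term_tendsto:
  assumes i: "i \<in> I"
  shows "((\<lambda>z. rate_term i (\<xi> i z)) \<longlongrightarrow> rate_term i (\<xi> i 1)) (at_left 1)"
proof (cases "\<xi> i 1 = 1")
  case False
  interpret Gi: group "G i" by (rule grp[OF i])
  have xi: "0 < \<xi> i 1" "\<xi> i 1 < 1" using xi_pos[OF i, of 1] xi_le_1[OF i, of 1] False by auto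
  have "isCont (Green i) (\<xi> i 1)"
    by (rule isCont_green) (use xi supp[OF i] Gi.is_group in auto)
  then have "isCont (rate_term i) (\<xi> i 1)"
    unfolding rate_term_def[abs_def] using xi by (intro continuous_intros) auto
  then show ?thesis using xi_tendsto[OF i] isCont_tendsto_compose by blast
next
  case True
  interpret Gi: group "G i" by (rule grp[OF i])
  have ev: "eventually (\<lambda>z. 0 < \<xi> i z \<and> \<xi> i z < 1) (at_left 1)"
    using eventually_at_left_real[of 0 1, OF zero_less_one] by eventually_elim (use xi_pos[OF i] xi_less_1[OF i] in auto)
  have "((\<lambda>z. (1 - \<xi> i z) / \<xi> i z) \<longlongrightarrow> (1 - 1) / 1) (at_left 1)"
    using xi_tendsto[OF i] True by (intro tendsto_intros) auto
  moreover have "eventually (\<lambda>z. norm (rate_term i (\<xi> i z)) \<le> (1 - \<xi> i z) / \<xi> i z) (at_left 1)"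
    using ev
  proof eventually_elim
    case (elim z)
    have supp': "set_pmf (\<mu> i) \<subseteq> carrier (G i)" using supp[OF i] by blast
    have "0 \<le> Green i (\<xi> i z)" "(1 - \<xi> i z) * Green i (\<xi> i z) \<le> 1"
      using green_bounds[OF Gi.is_group supp' Gi.one_closed] elim by auto
    then have "\<bar>1 - (1 - \<xi> i z) * Green i (\<xi> i z)\<bar> \<le> 1"
      using elim by (simp add: abs_le_iff)
    then have "(1 - \<xi> i z) / \<xi> i z * \<bar>1 - (1 - \<xi> i z) * Green i (\<xi> i z)\<bar> \<le> (1 - \<xi> i z) / \<xi> i z * 1"
      using elim by (intro mult_left_mono) auto
    then show ?case using elim by (simp add: rate_term_def abs_mult)
  qed
  ultimately have "((\<lambda>z. rate_term i (\<xi> i z)) \<longlongrightarrow> 0) (at_left 1)"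
    by (simp add: Lim_null_comparison)
  then show ?thesis by (simp add: True rate_term_def)
qed

lemma mean_gf_tendsto:
  "((\<lambda>z. (1 - z)\<^sup>2 * (\<Sum>n. mean (Suc n) * z ^ n)) \<longlongrightarrow> speed) (at_left 1)"
proof -
  have "((\<lambda>z. \<Sum>i\<in>I. \<alpha> i * rate_term i (\<xi> i z)) \<longlongrightarrow> speed) (at_left 1)"
    unfolding speed_def by (intro tendsto_sum tendsto_mult_left rate_term_tendsto)
  then show ?thesis
    by (rule Lim_transform_eventually)
       (use eventually_at_left_real[of 0 1, OF zero_less_one] in \<open>auto elim!: eventually_mono simp: mean_gf(1)\<close>)
qed

text \<open>
  Abel summation preserves linear bounds: the sequence \<open>n\<close> itself has the limit 1 under the
  normalisation of \<open>mean_gf_tendsto\<close>, and a constant has the limit 0.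
\<close>
lemma speed_ge:
  assumes c: "\<And>n. c * real n \<le> mean n"
  shows "c \<le> speed"
proof (rule tendsto_lowerbound[OF mean_gf_tendsto])
  show "eventually (\<lambda>z. c \<le> (1 - z)\<^sup>2 * (\<Sum>n. mean (Suc n) * z ^ n)) (at_left 1)"
    using eventually_at_left_real[of 0 1, OF zero_less_one]
  proof eventually_elim
    case (elim z)
    have g: "(\<lambda>n. c * (real (Suc n) * z ^ n)) sums (c * (1 / (1 - z)\<^sup>2))"
      using elim by (intro sums_mult geometric_deriv_sums) simp
    have "c * (1 / (1 - z)\<^sup>2) \<le> (\<Sum>n. mean (Suc n) * z ^ n)"
      unfolding sums_unique[OF g]
      using elim c[of "Suc _"]
      by (intro suminf_le sums_summable[OF g] mean_gf(2))
         (auto simp: mult.assoc[symmetric] intro!: mult_right_mono simp del: of_nat_Suc)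
    then have "(1 - z)\<^sup>2 * (c * (1 / (1 - z)\<^sup>2)) \<le> (1 - z)\<^sup>2 * (\<Sum>n. mean (Suc n) * z ^ n)"
      by (rule mult_left_mono) simp
    then show ?case using elim by simp
  qed
qed simp

lemma speed_le:
  assumes c: "\<And>n. mean n \<le> c * real n + d"
  shows "speed \<le> c"
proof -
  have "((\<lambda>z. c + d * (1 - z)) \<longlongrightarrow> c + d * (1 - 1)) (at_left (1 :: real))"
    by (intro tendsto_intros)
  then have lim: "((\<lambda>z. c + d * (1 - z)) \<longlongrightarrow> c) (at_left (1 :: real))" by simp
  show ?thesis
  proof (rule tendsto_le[OF _ lim mean_gf_tendsto])
    show "eventually (\<lambda>z. (1 - z)\<^sup>2 * (\<Sum>n. mean (Suc n) * z ^ n) \<le> c + d * (1 - z)) (at_left 1)"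
      using eventually_at_left_real[of 0 1, OF zero_less_one]
    proof eventually_elim
      case (elim z)
      have g: "(\<lambda>n. c * (real (Suc n) * z ^ n) + d * z ^ n) sums (c * (1 / (1 - z)\<^sup>2) + d * (1 / (1 - z)))"
        using elim by (intro sums_add sums_mult geometric_deriv_sums geometric_sums) auto
      have "mean (Suc n) * z ^ n \<le> c * (real (Suc n) * z ^ n) + d * z ^ n" for n
        using mult_right_mono[OF c[of "Suc n"], of "z ^ n"] elim by (simp add: algebra_simps)
      then have "(\<Sum>n. mean (Suc n) * z ^ n) \<le> c * (1 / (1 - z)\<^sup>2) + d * (1 / (1 - z))"
        unfolding sums_unique[OF g] using elim
        by (intro suminf_le sums_summable[OF g] mean_gf(2)) auto
      then have "(1 - z)\<^sup>2 * (\<Sum>n. mean (Suc n) * z ^ n) \<le>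
          (1 - z)\<^sup>2 * (c * (1 / (1 - z)\<^sup>2) + d * (1 / (1 - z)))"
        by (rule mult_left_mono) simp
      also have "\<dots> = c + d * (1 - z)"
      proof -
        have "w\<^sup>2 * (c * (1 / w\<^sup>2) + d * (1 / w)) = c + d * w" if "w \<noteq> 0" for w :: real
          using that by (simp add: power2_eq_square field_simps)
        then show ?thesis using elim by simp
      qed
      finally show ?case .
    qed
  qed simp
qed

lemma speed_le_mean: "0 < m \<Longrightarrow> speed * real m \<le> mean m"
  using speed_le[OF mean_linear_upper] by (simp add: field_simps)

lemma mean_close_to_speed:
  assumes "speed < c"
  obtains m where "0 < m" "mean m < c * real m"
proof (rule ccontr)
  assume "\<not> thesis"
  then have "c * real n \<le> mean n" for n
    using that[of n] mean_0 by (cases "n = 0") (auto simp: not_less[symmetric])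
  then show False using speed_ge assms by fastforce
qed

lemma prod_list_xi_le:
  assumes "\<And>i. i \<in> I \<Longrightarrow> \<xi> i 1 \<le> \<kappa>" "set u \<subseteq> B"
  shows "(\<Prod>a\<leftarrow>u. \<xi> (fst a) 1) \<le> \<kappa> ^ length u"
  using assms(2)
proof (induction u)
  case (Cons a u)
  then have a: "fst a \<in> I" by (auto simp: blocks_def)
  have "0 \<le> (\<Prod>a\<leftarrow>u. \<xi> (fst a) 1)"
    using Cons.prems xi_pos[of _ 1, THEN less_imp_le]
    by (intro prod_list_nonneg) (force simp: blocks_def)
  then show ?case
    using Cons assms(1)[OF a] xi_pos[OF a, of 1] by (auto intro!: mult_mono)
qed simp

text \<open>
  The expected number of blocks of \<open>x\<close> that the walk has cancelled at time \<open>n\<close> is at most a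
  geometric series in \<open>\<kappa>\<close>, uniformly in \<open>x\<close> and \<open>n\<close>.
\<close>
lemma mean_lower:
  assumes kap: "\<And>i. i \<in> I \<Longrightarrow> \<xi> i 1 \<le> \<kappa>" "0 \<le> \<kappa>" "\<kappa> < 1" and x: "x \<in> W"
  shows "real (length x) + mean n - (1 + 2 / (1 - \<kappa>)) \<le> expect (walk n x) (\<lambda>y. real (length y))"
proof -
  obtain u where u: "length u = length x" "set u \<subseteq> B"
    "\<And>y. y \<in> W \<Longrightarrow> length x + length y \<le>
      length (x \<star> y) + 1 + 2 * (\<Sum>c<length x. of_bool (take (Suc c) y = take (Suc c) u))"
    using length_star_ge[OF x] by blast
  let ?ind = "\<lambda>c y. indicator {y. take (Suc c) y = take (Suc c) u} y :: real"
  let ?S = "\<lambda>y. \<Sum>c<length x. ?ind c y"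
  have S: "\<bar>?S y\<bar> \<le> real (length x)" for y
    using sum_abs[of "\<lambda>c. ?ind c y" "{..<length x}"] sum_bounded_above[of "{..<length x}" "\<lambda>c. \<bar>?ind c y\<bar>" 1]
    by (force simp: indicator_def)
  have one: "expect (walk n []) (?ind c) \<le> \<kappa> ^ Suc c" if c: "c < length x" for c
  proof -
    let ?u = "take (Suc c) u"
    have lu: "length ?u = Suc c" using c u(1) by simp
    have su: "set ?u \<subseteq> B" using u(2) set_take_subset[of "Suc c" u] by blast
    have "expect (walk n []) (?ind c) = measure_pmf.prob (walk n []) {y. take (length ?u) y = ?u}"
      using lu by simp
    also have "\<dots> \<le> (\<Prod>a\<leftarrow>?u. \<xi> (fst a) 1)" by (rule prob_prefix_le[OF su])
    also have "\<dots> \<le> \<kappa> ^ length ?u" by (rule prod_list_xi_le[OF kap(1) su])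
    finally show ?thesis using lu by simp
  qed
  have "expect (walk n []) ?S = (\<Sum>c<length x. expect (walk n []) (?ind c))"
    by (rule expect_sum[where c = 1]) (simp add: indicator_def)
  also have "\<dots> \<le> (\<Sum>c<length x. \<kappa> ^ Suc c)" by (intro sum_mono one) simp
  also have "\<dots> \<le> (\<Sum>c<length x. \<kappa> ^ c)"
    using kap by (intro sum_mono power_decreasing) auto
  also have "\<dots> \<le> (\<Sum>c. \<kappa> ^ c)"
    using kap by (intro sum_le_suminf summable_geometric) auto
  also have "\<dots> = 1 / (1 - \<kappa>)" using kap by (simp add: suminf_geometric)
  finally have ES: "expect (walk n []) ?S \<le> 1 / (1 - \<kappa>)" .
  have "real (length x) + mean n = expect (walk n []) (\<lambda>y. real (length x) + real (length y))"
    unfolding mean_def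
    by (subst expect_add[where c = "real (length x)" and d = "real n"])
       (use walk_length_Nil in auto)
  also have "\<dots> \<le> expect (walk n []) (\<lambda>y. real (length (x \<star> y)) + (1 + 2 * ?S y))"
  proof (rule expect_mono[where c = "real (length x) + real n" and
        d = "(real (length x) + real n) + (1 + 2 * real (length x))"])
    fix y assume y: "y \<in> set_pmf (walk n [])"
    have yW: "y \<in> W" using walk_W[OF _ y] by simp
    have "real (length x + length y) \<le>
        real (length (x \<star> y) + 1 + 2 * (\<Sum>c<length x. of_bool (take (Suc c) y = take (Suc c) u)))"
      using u(3)[OF yW] by (simp only: of_nat_le_iff)
    moreover have "real (\<Sum>c<length x. of_bool (take (Suc c) y = take (Suc c) u)) = ?S y"
      by (simp add: indicator_def)
    ultimately show "real (length x) + real (length y) \<le> real (length (x \<star> y)) + (1 + 2 * ?S y)"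
      by simp
    show "\<bar>real (length x) + real (length y)\<bar> \<le> real (length x) + real n"
      using walk_length_Nil[OF y] by linarith
    have "real (length (x \<star> y)) \<le> real (length x) + real n"
      using length_star[of x y] walk_length_Nil[OF y] by linarith
    then show "\<bar>real (length (x \<star> y)) + (1 + 2 * ?S y)\<bar> \<le>
        (real (length x) + real n) + (1 + 2 * real (length x))"
      using S[of y] by linarith
  qed
  also have "\<dots> = expect (walk n []) (\<lambda>y. real (length (x \<star> y))) + (1 + 2 * expect (walk n []) ?S)"
  proof (subst expect_add[where c = "real (length x) + real n" and d = "1 + 2 * real (length x)"])
    fix y assume y: "y \<in> set_pmf (walk n [])"
    show "\<bar>real (length (x \<star> y))\<bar> \<le> real (length x) + real n"
      using length_star[of x y] walk_length_Nil[OF y] by linarith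
    show "\<bar>1 + 2 * ?S y\<bar> \<le> 1 + 2 * real (length x)" using S[of y] by linarith
  next
    have "\<bar>2 * ?S y\<bar> \<le> 2 * real (length x)" for y using S[of y] by linarith
    then have "expect (walk n []) (\<lambda>y. 1 + 2 * ?S y) = 1 + expect (walk n []) (\<lambda>y. 2 * ?S y)"
      by (subst expect_add[where c = 1 and d = "2 * real (length x)"]) auto
    then show "expect (walk n []) (\<lambda>y. real (length (x \<star> y))) + expect (walk n []) (\<lambda>y. 1 + 2 * ?S y) =
        expect (walk n []) (\<lambda>y. real (length (x \<star> y))) + (1 + 2 * expect (walk n []) ?S)"
      by simp
  qed
  also have "expect (walk n []) (\<lambda>y. real (length (x \<star> y))) = expect (walk n x) (\<lambda>y. real (length y))"
    by (rule expect_walk_from[OF x, symmetric])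
  finally show ?thesis using ES by simp
qed


section \<open>Concentration of the length\<close>

text \<open>
  The quadratic bound on the exponential turns a bound on the mean increment into one on the
  exponential moment, with an error of second order in \<open>\<theta>\<close>.
\<close>
lemma exp_moment_block:
  assumes lip: "\<And>y. y \<in> set_pmf (walk m x) \<Longrightarrow> \<bar>F y - F x\<bar> \<le> real m"
    and drift: "expect (walk m x) F \<le> F x + b"
    and \<theta>: "0 \<le> \<theta>" "\<theta> * real m \<le> 1"
  shows "expect (walk m x) (\<lambda>y. exp (\<theta> * F y)) \<le> exp (\<theta> * F x + (\<theta> * b + (\<theta> * real m)\<^sup>2))"
proof -
  let ?D = "\<lambda>y. F y - F x"
  have D: "\<bar>\<theta> * ?D y\<bar> \<le> \<theta> * real m" if "y \<in> set_pmf (walk m x)" for y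
    using lip[OF that] \<theta> by (simp add: abs_mult mult_left_mono)
  have Fb: "\<bar>F y\<bar> \<le> \<bar>F x\<bar> + real m" if "y \<in> set_pmf (walk m x)" for y
    using lip[OF that] by linarith
  have "expect (walk m x) (\<lambda>y. exp (\<theta> * F y)) \<le>
      expect (walk m x) (\<lambda>y. exp (\<theta> * F x) * (1 + \<theta> * ?D y + (\<theta> * real m)\<^sup>2))"
  proof (rule expect_mono[where c = "exp (\<theta> * (\<bar>F x\<bar> + real m))" and d = "exp (\<theta> * F x) * (1 + \<theta> * real m + (\<theta> * real m)\<^sup>2)"])
    fix y assume y: "y \<in> set_pmf (walk m x)"
    have "exp (\<theta> * ?D y) \<le> 1 + \<theta> * ?D y + (\<theta> * ?D y)\<^sup>2"
      by (rule exp_le_quadratic) (use D[OF y] \<theta> in linarith)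
    also have "(\<theta> * ?D y)\<^sup>2 \<le> (\<theta> * real m)\<^sup>2"
      using D[OF y] by (metis abs_ge_zero power2_abs power_mono)
    finally have "exp (\<theta> * F x) * exp (\<theta> * ?D y) \<le> exp (\<theta> * F x) * (1 + \<theta> * ?D y + (\<theta> * real m)\<^sup>2)"
      by (intro mult_left_mono) auto
    then show "exp (\<theta> * F y) \<le> exp (\<theta> * F x) * (1 + \<theta> * ?D y + (\<theta> * real m)\<^sup>2)"
      by (simp add: exp_add[symmetric] algebra_simps)
    show "\<bar>exp (\<theta> * F y)\<bar> \<le> exp (\<theta> * (\<bar>F x\<bar> + real m))"
      using Fb[OF y] \<theta> by (auto intro!: mult_left_mono)
    have "0 \<le> (\<theta> * real m)\<^sup>2" by simp
    then have "\<bar>1 + \<theta> * ?D y + (\<theta> * real m)\<^sup>2\<bar> \<le> 1 + \<theta> * real m + (\<theta> * real m)\<^sup>2"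
      using D[OF y] \<theta> by linarith
    then show "\<bar>exp (\<theta> * F x) * (1 + \<theta> * ?D y + (\<theta> * real m)\<^sup>2)\<bar> \<le>
        exp (\<theta> * F x) * (1 + \<theta> * real m + (\<theta> * real m)\<^sup>2)"
      by (simp add: abs_mult)
  qed
  also have "\<dots> = exp (\<theta> * F x) * (1 + \<theta> * (expect (walk m x) F - F x) + (\<theta> * real m)\<^sup>2)"
  proof -
    have "integrable (walk m x) F" by (rule integrable_pmf_bounded[OF Fb])
    then show ?thesis by simp
  qed
  also have "\<dots> \<le> exp (\<theta> * F x) * (1 + \<theta> * b + (\<theta> * real m)\<^sup>2)"
    using drift \<theta> by (intro mult_left_mono add_mono) auto
  also have "\<dots> \<le> exp (\<theta> * F x) * exp (\<theta> * b + (\<theta> * real m)\<^sup>2)"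
    using exp_ge_add_one_self[of "\<theta> * b + (\<theta> * real m)\<^sup>2"] by (intro mult_left_mono) (auto simp: add_ac)
  finally show ?thesis by (simp add: exp_add)
qed

lemma exp_moment:
  assumes lip: "\<And>n x y. x \<in> W \<Longrightarrow> y \<in> set_pmf (walk n x) \<Longrightarrow> \<bar>F y - F x\<bar> \<le> real n"
    and drift: "\<And>x. x \<in> W \<Longrightarrow> expect (walk m x) F \<le> F x + b"
    and \<theta>: "0 \<le> \<theta>" "\<theta> * real m \<le> 1" and x: "x \<in> W"
  shows "expect (walk (k * m + s) x) (\<lambda>y. exp (\<theta> * F y)) \<le>
    exp (\<theta> * F x + real k * (\<theta> * b + (\<theta> * real m)\<^sup>2) + \<theta> * real s)"
  using x
proof (induction k arbitrary: x)
  case 0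
  show ?case
  proof (simp, rule expect_le)
    fix y assume "y \<in> set_pmf (walk s x)"
    then have "F y \<le> F x + real s" using lip[OF 0] by force
    then have "\<theta> * F y \<le> \<theta> * (F x + real s)" using \<theta> by (rule_tac mult_left_mono)
    then show "exp (\<theta> * F y) \<le> exp (\<theta> * F x + \<theta> * real s)" by (simp add: distrib_left)
  qed simp
next
  case (Suc k)
  let ?n = "k * m + s"
  let ?K = "exp (real k * (\<theta> * b + (\<theta> * real m)\<^sup>2) + \<theta> * real s)"
  have bound: "\<bar>exp (\<theta> * F y)\<bar> \<le> exp (\<theta> * (\<bar>F x\<bar> + real n))"
    if "y \<in> set_pmf (walk n x)" for n y
    using lip[OF Suc.prems that] \<theta> by (auto intro!: mult_left_mono)
  have "expect (walk (Suc k * m + s) x) (\<lambda>y. exp (\<theta> * F y)) =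
      expect (walk m x) (\<lambda>w. expect (walk ?n w) (\<lambda>y. exp (\<theta> * F y)))"
    unfolding mult_Suc add.assoc walk_add[of m]
    by (rule expect_bind_pmf[where c = "exp (\<theta> * (\<bar>F x\<bar> + real (m + ?n)))"], rule bound)
       (auto simp: walk_add[of m])
  also have "\<dots> \<le> expect (walk m x) (\<lambda>w. ?K * exp (\<theta> * F w))"
  proof (rule expect_mono[where c = "exp (\<theta> * (\<bar>F x\<bar> + real (m + ?n)))" and d = "?K * exp (\<theta> * (\<bar>F x\<bar> + real m))"])
    fix w assume w: "w \<in> set_pmf (walk m x)"
    then have wW: "w \<in> W" using walk_W[OF Suc.prems] by blast
    show "expect (walk ?n w) (\<lambda>y. exp (\<theta> * F y)) \<le> ?K * exp (\<theta> * F w)"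
      using Suc.IH[OF wW] by (simp add: exp_add[symmetric] algebra_simps)
    show "\<bar>expect (walk ?n w) (\<lambda>y. exp (\<theta> * F y))\<bar> \<le> exp (\<theta> * (\<bar>F x\<bar> + real (m + ?n)))"
      by (rule expect_abs_le, rule bound) (use w in \<open>auto simp: walk_add[of m]\<close>)
    show "\<bar>?K * exp (\<theta> * F w)\<bar> \<le> ?K * exp (\<theta> * (\<bar>F x\<bar> + real m))"
      using bound[OF w] by (simp add: abs_mult)
  qed
  also have "\<dots> = ?K * expect (walk m x) (\<lambda>w. exp (\<theta> * F w))" by simp
  also have "\<dots> \<le> ?K * exp (\<theta> * F x + (\<theta> * b + (\<theta> * real m)\<^sup>2))"
    by (intro mult_left_mono exp_moment_block lip drift \<theta> Suc.prems) auto
  also have "\<dots> = exp (\<theta> * F x + real (Suc k) * (\<theta> * b + (\<theta> * real m)\<^sup>2) + \<theta> * real s)"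
    by (simp add: exp_add[symmetric] algebra_simps)
  finally show ?case .
qed

text \<open>
  By Markov's inequality for \<open>exp (\<theta> * F)\<close>. Over one block of \<open>m\<close> steps, the exponent loses
  \<open>\<theta> * \<delta>\<close> with \<open>\<delta> = c * m - b\<close> and gains at most \<open>(\<theta> * m)\<^sup>2\<close>; the choice of \<open>\<theta>\<close> limits the gain
  to at most half of the loss.
\<close>
lemma exponential_tail:
  assumes lip: "\<And>n x y. x \<in> W \<Longrightarrow> y \<in> set_pmf (walk n x) \<Longrightarrow> \<bar>F y - F x\<bar> \<le> real n"
    and drift: "\<And>x. x \<in> W \<Longrightarrow> expect (walk m x) F \<le> F x + b"
    and F0: "F [] = 0" and m: "0 < m" and c: "b < c * real m"
  obtains K \<rho> where "0 \<le> \<rho>" "\<rho> < 1"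
    "\<And>n. measure_pmf.prob (walk n []) {y. c * real n \<le> F y} \<le> K * \<rho> ^ n"
proof -
  define \<delta> where "\<delta> = c * real m - b"
  define \<theta> where "\<theta> = min (1 / real m) (\<delta> / (2 * (real m)\<^sup>2))"
  have \<delta>: "0 < \<delta>" using c by (simp add: \<delta>_def)
  have \<theta>: "0 < \<theta>" "\<theta> * real m \<le> 1" "\<theta> * (real m)\<^sup>2 \<le> \<delta> / 2"
    using m \<delta> by (auto simp: \<theta>_def min_def field_simps split: if_splits)
  define C where "C = \<theta> * \<delta> / 2 + \<theta> * real m * (1 + \<bar>c\<bar>)"
  define \<eta> where "\<eta> = \<theta> * \<delta> / (2 * real m)"
  have \<eta>: "0 < \<eta>" using \<theta> \<delta> m by (simp add: \<eta>_def)
  show ?thesis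
  proof (rule that[of "exp (- \<eta>)" "exp C"])
    show "exp (- \<eta>) < 1" using \<eta> by simp
    fix n
    define k where "k = n div m"
    define s where "s = n mod m"
    have n: "n = k * m + s" by (simp add: k_def s_def)
    have s: "s < m" using m by (simp add: s_def)
    have bd: "\<bar>F y\<bar> \<le> real n" if "y \<in> set_pmf (walk n [])" for y
      using lip[OF Nil_W that] F0 by simp
    have "measure_pmf.prob (walk n []) {y. c * real n \<le> F y} =
        expect (walk n []) (indicator {y. c * real n \<le> F y})" by simp
    also have "\<dots> \<le> expect (walk n []) (\<lambda>y. exp (- \<theta> * c * real n) * exp (\<theta> * F y))"
    proof (rule expect_mono[where c = 1 and d = "exp (- \<theta> * c * real n) * exp (\<theta> * real n)"])
      fix y assume y: "y \<in> set_pmf (walk n [])"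
      show "indicator {y. c * real n \<le> F y} y \<le> exp (- \<theta> * c * real n) * exp (\<theta> * F y)"
        using \<theta>(1) mult_left_mono[of "c * real n" "F y" \<theta>]
        by (auto simp: indicator_def mult_exp_exp mult.assoc)
      show "\<bar>exp (- \<theta> * c * real n) * exp (\<theta> * F y)\<bar> \<le> exp (- \<theta> * c * real n) * exp (\<theta> * real n)"
        using bd[OF y] \<theta>(1) by (simp add: abs_mult)
    qed (simp add: indicator_def)
    also have "\<dots> = exp (- \<theta> * c * real n) * expect (walk n []) (\<lambda>y. exp (\<theta> * F y))" by simp
    also have "\<dots> \<le> exp (- \<theta> * c * real n) *
        exp (\<theta> * F [] + real k * (\<theta> * b + (\<theta> * real m)\<^sup>2) + \<theta> * real s)"
      unfolding n using \<theta>(1,2) by (intro mult_left_mono exp_moment lip drift) auto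
    also have "\<dots> = exp (real k * (\<theta> * b + (\<theta> * real m)\<^sup>2) + \<theta> * real s - \<theta> * c * real n)"
      by (simp add: F0 mult_exp_exp)
    also have "\<dots> \<le> exp (C - \<eta> * real n)"
    proof (simp only: exp_le_cancel_iff)
      have 1: "\<theta> * b + (\<theta> * real m)\<^sup>2 \<le> \<theta> * (b + \<delta> / 2)"
      proof -
        have "\<theta> * (\<theta> * (real m)\<^sup>2) \<le> \<theta> * (\<delta> / 2)" using \<theta> by (intro mult_left_mono) auto
        then show ?thesis by (simp add: power2_eq_square algebra_simps)
      qed
      have "real k * (\<theta> * b + (\<theta> * real m)\<^sup>2) + \<theta> * real s - \<theta> * c * real n \<le>
          real k * (\<theta> * (b + \<delta> / 2)) + \<theta> * real s - \<theta> * c * real n"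
        using mult_left_mono[OF 1, of "real k"] by simp
      also have "\<dots> = - (real k * (\<theta> * \<delta> / 2)) + \<theta> * real s * (1 - c)"
        by (simp add: n \<delta>_def algebra_simps)
      also have "\<theta> * real s * (1 - c) \<le> \<theta> * real m * (1 + \<bar>c\<bar>)"
      proof -
        have "\<theta> * real s * (1 - c) \<le> \<theta> * real s * (1 + \<bar>c\<bar>)" using \<theta> by (intro mult_left_mono) auto
        also have "\<dots> \<le> \<theta> * real m * (1 + \<bar>c\<bar>)" using \<theta> s by (intro mult_right_mono mult_left_mono) auto
        finally show ?thesis .
      qed
      finally have 2: "real k * (\<theta> * b + (\<theta> * real m)\<^sup>2) + \<theta> * real s - \<theta> * c * real n \<le>
          - (real k * (\<theta> * \<delta> / 2)) + \<theta> * real m * (1 + \<bar>c\<bar>)" by simp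
      have "real n \<le> real m * (real k + 1)" using n s by (simp add: algebra_simps)
      then have "\<eta> * real n \<le> \<eta> * (real m * (real k + 1))" using \<eta> by (intro mult_left_mono) auto
      also have "\<dots> = (\<theta> * \<delta> / 2) * (real k + 1)" using m by (simp add: \<eta>_def)
      finally have 3: "\<eta> * real n \<le> real k * (\<theta> * \<delta> / 2) + \<theta> * \<delta> / 2" by (simp add: algebra_simps)
      show "real k * (\<theta> * b + (\<theta> * real m)\<^sup>2) + \<theta> * real s - \<theta> * c * real n \<le> C - \<eta> * real n"
        using 2 3 unfolding C_def by linarith
    qed
    also have "\<dots> = exp C * exp (- \<eta>) ^ n"
      by (simp add: exp_diff exp_of_nat_mult[symmetric] exp_minus field_simps)
    finally show "measure_pmf.prob (walk n []) {y. c * real n \<le> F y} \<le> exp C * exp (- \<eta>) ^ n" .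
  qed simp
qed

lemma upper_tail:
  assumes "speed < c"
  obtains K \<rho> where "0 \<le> \<rho>" "\<rho> < 1"
    "\<And>n. measure_pmf.prob (walk n []) {y. c * real n \<le> real (length y)} \<le> K * \<rho> ^ n"
proof -
  obtain m where m: "0 < m" "mean m < c * real m" using mean_close_to_speed[OF assms] by blast
  show ?thesis
    by (rule exponential_tail[where F = "\<lambda>y. real (length y)" and m = m and b = "mean m" and c = c])
       (use m that walk_length mean_upper in auto)
qed

lemma lower_tail:
  assumes "c < speed"
  obtains K \<rho> where "0 \<le> \<rho>" "\<rho> < 1"
    "\<And>n. measure_pmf.prob (walk n []) {y. real (length y) \<le> c * real n} \<le> K * \<rho> ^ n"
proof (cases "\<exists>i\<in>I. \<xi> i 1 = 1")
  case True
  then have "\<xi> i 1 = 1" if "i \<in> I" for i using xi_dichotomy that by blast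
  then have "speed = 0" by (simp add: speed_def rate_term_def)
  then have "c < 0" using assms by simp
  then have e: "{y. real (length y) \<le> c * real n} = {}" if "0 < n" for n
    using mult_neg_pos[of c "real n"] that by (auto simp: not_le intro: less_le_trans)
  have "measure_pmf.prob (walk n []) {y. real (length y) \<le> c * real n} \<le> 1 * 0 ^ n" for n
  proof (cases "n = 0")
    case False
    then show ?thesis by (subst e) auto
  qed simp
  then show ?thesis using that[of 0 1] by simp
next
  case False
  have ne: "I \<noteq> {}" using alpha_sum by auto
  define \<kappa> where "\<kappa> = Max ((\<lambda>i. \<xi> i 1) ` I)"
  have \<kappa>: "\<xi> i 1 \<le> \<kappa>" if "i \<in> I" for i unfolding \<kappa>_def using fin that by simp
  have "\<kappa> \<in> (\<lambda>i. \<xi> i 1) ` I" unfolding \<kappa>_def using fin ne by (intro Max_in) auto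
  then have \<kappa>01: "0 \<le> \<kappa>" "\<kappa> < 1" using xi_pos[of _ 1] xi_le_1[of _ 1] False by force+
  define C where "C = 1 + 2 / (1 - \<kappa>)"
  \<comment> \<open>Over \<open>m\<close> steps the fixed loss \<open>C\<close> must be smaller than the gap \<open>(speed - c) * m\<close>.\<close>
  obtain m0 :: nat where m0: "C / (speed - c) < real m0" using reals_Archimedean2 by blast
  define m where "m = Suc m0"
  have m: "0 < m" "C < (speed - c) * real m"
    using m0 assms by (auto simp: m_def field_simps)
  have d: "expect (walk m x) (\<lambda>y. - real (length y)) \<le> - real (length x) + (C - mean m)" if "x \<in> W" for x
    using mean_lower[OF \<kappa> \<kappa>01 that, of m] by (simp add: C_def)
  have lt: "C - mean m < - c * real m" using m speed_le_mean[OF m(1)] by (simp add: algebra_simps)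
  obtain K \<rho> where *: "0 \<le> \<rho>" "\<rho> < 1"
    "\<And>n. measure_pmf.prob (walk n []) {y. - c * real n \<le> - real (length y)} \<le> K * \<rho> ^ n"
    by (rule exponential_tail[where F = "\<lambda>y. - real (length y)" and m = m and b = "C - mean m" and c = "- c"])
       (use m lt d walk_length in \<open>auto simp: abs_minus_commute\<close>)
  show ?thesis by (rule that[of \<rho> K]) (use * in auto)
qed

lemma AE_speed:
  assumes "prob_space M"
    and Z: "\<And>n. Z n \<in> M \<rightarrow>\<^sub>M count_space W"
    and law: "\<And>n A. measure M {\<omega> \<in> space M. Z n \<omega> \<in> A} = measure_pmf.prob (walk n []) A"
  shows "AE \<omega> in M. (\<lambda>n. real (length (Z n \<omega>)) / real n) \<longlonglongrightarrow> speed"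
proof -
  interpret prob_space M by fact
  have bc: "AE \<omega> in M. eventually (\<lambda>n. Z n \<omega> \<notin> A n) sequentially"
    if b: "0 \<le> \<rho>" "\<rho> < 1" "\<And>n. measure_pmf.prob (walk n []) (A n) \<le> K * \<rho> ^ n" for A K \<rho>
  proof -
    have "AE \<omega> in M. eventually (\<lambda>n. \<omega> \<in> space M - {\<omega> \<in> space M. Z n \<omega> \<in> A n}) sequentially"
    proof (rule borel_cantelli_AE1)
      show "{\<omega> \<in> space M. Z n \<omega> \<in> A n} \<in> sets M" for n
        using measurable_sets[OF Z[of n], of "A n \<inter> W"] measurable_space[OF Z[of n]]
        by (auto simp: vimage_def Int_def conj_commute cong: conj_cong)
      show "summable (\<lambda>n. measure M {\<omega> \<in> space M. Z n \<omega> \<in> A n})"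
        by (rule summable_comparison_test[OF _ summable_mult[OF summable_geometric[of \<rho>], of K]])
           (use b in \<open>auto simp: law\<close>)
    qed (simp add: emeasure_eq_measure)
    then show ?thesis by eventually_elim (auto elim: eventually_mono)
  qed
  have up: "AE \<omega> in M. eventually (\<lambda>n. real (length (Z n \<omega>)) < c * real n) sequentially" if "speed < c" for c
  proof (rule upper_tail[OF that])
    fix K \<rho> :: real assume "0 \<le> \<rho>" "\<rho> < 1"
      "\<And>n. measure_pmf.prob (walk n []) {y. c * real n \<le> real (length y)} \<le> K * \<rho> ^ n"
    from bc[OF this] show ?thesis by (simp add: not_le)
  qed
  have lo: "AE \<omega> in M. eventually (\<lambda>n. c * real n < real (length (Z n \<omega>))) sequentially" if "c < speed" for c
  proof (rule lower_tail[OF that])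
    fix K \<rho> :: real assume "0 \<le> \<rho>" "\<rho> < 1"
      "\<And>n. measure_pmf.prob (walk n []) {y. real (length y) \<le> c * real n} \<le> K * \<rho> ^ n"
    from bc[OF this] show ?thesis by (simp add: not_le)
  qed
  let ?e = "\<lambda>k. 1 / real (Suc k)"
  have "AE \<omega> in M. \<forall>k. eventually (\<lambda>n. real (length (Z n \<omega>)) < (speed + ?e k) * real n) sequentially"
    unfolding AE_all_countable by (intro allI up) simp
  moreover have "AE \<omega> in M. \<forall>k. eventually (\<lambda>n. (speed - ?e k) * real n < real (length (Z n \<omega>))) sequentially"
    unfolding AE_all_countable by (intro allI lo) simp
  ultimately show ?thesis
  proof eventually_elim
    case (elim \<omega>)
    show ?case
    proof (rule tendstoI)
      fix e :: real assume "0 < e"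
      then obtain k where k: "?e k < e" using nat_approx_posE by blast
      have "eventually (\<lambda>n. real (length (Z n \<omega>)) < (speed + ?e k) * real n) sequentially"
        "eventually (\<lambda>n. (speed - ?e k) * real n < real (length (Z n \<omega>))) sequentially"
        using elim by auto
      then show "eventually (\<lambda>n. dist (real (length (Z n \<omega>)) / real n) speed < e) sequentially"
        using eventually_gt_at_top[of "0 :: nat"]
      proof eventually_elim
        case (elim n)
        then have "real (length (Z n \<omega>)) / real n < speed + ?e k"
          "speed - ?e k < real (length (Z n \<omega>)) / real n"
          by (simp_all only: pos_divide_less_eq pos_less_divide_eq of_nat_0_less_iff)
        then show ?case using k by (simp only: dist_real_def abs_less_iff) linarith
      qed
    qed
  qed
qed


section \<open>From the Markov chain to the walk\<close>

lemma pmf_step: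
  assumes "d \<in> W"
  shows "pmf step d = (case d of [(i, g)] \<Rightarrow> \<alpha> i * pmf (\<mu> i) g | _ \<Rightarrow> 0)"
proof -
  have p: "pmf step d = (\<Sum>i\<in>I. \<alpha> i * expect (\<mu> i) (\<lambda>g. indicator {d} [(i, g)]))"
    by (subst expect_step[symmetric, where c = 1]) (auto simp: indicator_def pmf.rep_eq)
  show ?thesis
  proof (cases "\<exists>i g. d = [(i, g)]")
    case True
    then obtain j h where d: "d = [(j, h)]" by blast
    have j: "j \<in> I" using assms by (auto simp: d blocks_def)
    have "pmf step d = (\<Sum>i\<in>I. if i = j then \<alpha> j * pmf (\<mu> j) h else 0)"
      unfolding p
    proof (intro sum.cong refl)
      fix i assume "i \<in> I"
      have "(\<lambda>g. indicator {d} [(i, g)] :: real) = (if i = j then indicator {h} else (\<lambda>_. 0))"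
        by (auto simp: d indicator_def)
      then show "\<alpha> i * expect (\<mu> i) (\<lambda>g. indicator {d} [(i, g)]) = (if i = j then \<alpha> j * pmf (\<mu> j) h else 0)"
        by (simp add: pmf.rep_eq)
    qed
    then show ?thesis using j fin by (simp add: d)
  next
    case False
    then have "[(i, g)] \<noteq> d" for i g by metis
    then have "(\<lambda>g. indicator {d} [(i, g)] :: real) = (\<lambda>_. 0)" for i by (auto simp: indicator_def)
    then have "pmf step d = 0" unfolding p by simp
    then show ?thesis using False by (auto split: list.split)
  qed
qed

lemma free_trans_eq_pmf:
  assumes x: "x \<in> W" and y: "y \<in> W"
  shows "free_trans G I \<alpha> \<mu> x y = pmf (map_pmf ((\<star>) x) step) y"
proof -
  interpret F: group "free_product G I" by (rule group_free_product[OF grp])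
  let ?d = "inv\<^bsub>free_product G I\<^esub> x \<otimes>\<^bsub>free_product G I\<^esub> y"
  have d: "?d \<in> W" using x y by simp
  have mult: "u \<otimes>\<^bsub>free_product G I\<^esub> v = u \<star> v" for u v by (simp add: free_product_simps)
  have iff: "x \<star> s = y \<longleftrightarrow> s = ?d" if "s \<in> W" for s
    unfolding mult[symmetric] using F.inv_solve_left[OF that x y] by metis
  have "pmf (map_pmf ((\<star>) x) step) y = measure_pmf.prob step ((\<star>) x -` {y})"
    by (simp add: pmf_map)
  also have "\<dots> = measure_pmf.prob step {?d}"
  proof (rule measure_pmf.finite_measure_eq_AE)
    show "AE s in step. s \<in> (\<star>) x -` {y} \<longleftrightarrow> s \<in> {?d}"
      unfolding AE_measure_pmf_iff using iff step_W by blast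
  qed simp_all
  also have "\<dots> = pmf step ?d" by (simp add: pmf.rep_eq)
  finally show ?thesis unfolding free_trans_def pmf_step[OF d] by simp
qed

text \<open>
  The probability that the next steps of the walk from \<open>x\<close> fall into the given sets one after the
  other. The marginal laws and the law of the first excursion are both of this form.
\<close>
primrec visits :: "(nat \<times> 'a) list set list \<Rightarrow> (nat \<times> 'a) list \<Rightarrow> ennreal" where
  "visits [] x = 1"
| "visits (A # As) x = (\<integral>\<^sup>+s. indicator A (x \<star> s) * visits As (x \<star> s) \<partial>step)"

lemma visits_last: "visits (replicate n UNIV @ [A]) x = emeasure (walk (Suc n) x) A"
  by (induction n arbitrary: x) simp_all

lemma visits_first_hit:
  "visits (replicate m (- {[]}) @ [{[]}]) x = ennreal (expect step (\<lambda>s. first_hit m (x \<star> s)))"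
proof (induction m arbitrary: x)
  case 0
  show ?case
    by (simp, subst nn_integral_eq_integral[symmetric])
       (auto intro!: integrable_pmf_bounded[where c = 1] nn_integral_cong simp: indicator_def)
next
  case (Suc m)
  have "visits (replicate (Suc m) (- {[]}) @ [{[]}]) x = (\<integral>\<^sup>+s. ennreal (first_hit (Suc m) (x \<star> s)) \<partial>step)"
    by (auto simp: Suc.IH indicator_def intro!: nn_integral_cong)
  also have "\<dots> = ennreal (expect step (\<lambda>s. first_hit (Suc m) (x \<star> s)))"
    by (intro nn_integral_eq_integral integrable_pmf_bounded[where c = 1] first_hit_abs)
       (simp add: first_hit_bounds del: first_hit.simps)
  finally show ?case .
qed

lemma block_notin_embed:
  "(j, g) \<in> B \<Longrightarrow> [(j, g)] \<in> embed G i ` carrier (G i) \<longleftrightarrow> j = i"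
  by (auto simp: embed_def blocks_def image_iff)

lemma visits_excursion:
  assumes i: "i \<in> I"
  shows "visits ((- (embed G i ` carrier (G i))) # replicate m (- {[]}) @ [{[]}]) [] = ennreal (ret i (Suc m))"
proof -
  let ?f = "\<lambda>s. indicator (- (embed G i ` carrier (G i))) s * first_hit (Suc m) s"
  have f: "\<bar>?f s\<bar> \<le> 1" for s using first_hit_abs[of "Suc m" s] by (simp add: indicator_def)
  have "visits ((- (embed G i ` carrier (G i))) # replicate m (- {[]}) @ [{[]}]) [] = (\<integral>\<^sup>+s. ennreal (?f s) \<partial>step)"
    unfolding visits.simps visits_first_hit
    by (intro nn_integral_cong_AE) (auto simp: AE_measure_pmf_iff indicator_def elim: step_block)
  also have "\<dots> = ennreal (expect step ?f)"
    using f first_hit_bounds by (intro nn_integral_eq_integral integrable_pmf_bounded[where c = 1]) auto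
  also have "expect step ?f = (\<Sum>j\<in>I. \<alpha> j * expect (\<mu> j) (\<lambda>g. ?f [(j, g)]))"
    by (rule expect_step[where c = 1]) (rule f)
  also have "\<dots> = (\<Sum>j\<in>I. if j = i then 0 else \<alpha> j * expect (\<mu> j) (\<lambda>g. first_hit (Suc m) [(j, g)]))"
  proof (intro sum.cong refl)
    fix j assume j: "j \<in> I"
    have "expect (\<mu> j) (\<lambda>g. ?f [(j, g)]) =
        expect (\<mu> j) (\<lambda>g. if j = i then 0 else first_hit (Suc m) [(j, g)])"
      by (intro expect_cong) (use block_notin_embed[OF mu_B[OF j]] in \<open>auto simp: indicator_def\<close>)
    then show "\<alpha> j * expect (\<mu> j) (\<lambda>g. ?f [(j, g)]) =
        (if j = i then 0 else \<alpha> j * expect (\<mu> j) (\<lambda>g. first_hit (Suc m) [(j, g)]))"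
      by simp
  qed
  also have "\<dots> = ret i (Suc m)"
    unfolding ret_def using fin i by (subst sum.remove[OF fin i]) (auto intro!: sum.cong)
  finally show ?thesis .
qed

lemma ret_0: "ret i 0 = 0"
  by (simp add: ret_def)

context
  fixes M :: "'w measure" and Z :: "nat \<Rightarrow> 'w \<Rightarrow> (nat \<times> 'a) list"
  assumes chain: "markov_chain_from M W (free_trans G I \<alpha> \<mu>) [] Z"
    and countable_W: "countable W"
begin

lemma chain_facts:
  "prob_space M" "Z n \<in> M \<rightarrow>\<^sub>M count_space W"
  using chain by (auto simp: markov_chain_from_def)

lemma sets_chain [measurable]: "Measurable.pred M (\<lambda>\<omega>. Z n \<omega> \<in> A)"
  using chain_facts(2)[of n] by (rule measurable_compose) simp

lemma sets_chain_eq [measurable]: "Measurable.pred M (\<lambda>\<omega>. Z n \<omega> = x)"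
  using sets_chain[of n "{x}"] by simp

lemma chain_path_Suc:
  assumes "\<And>k. k \<le> Suc n \<Longrightarrow> x k \<in> W"
  shows "emeasure M {\<omega> \<in> space M. \<forall>k\<le>Suc n. Z k \<omega> = x k} =
    emeasure M {\<omega> \<in> space M. \<forall>k\<le>n. Z k \<omega> = x k} * pmf (map_pmf ((\<star>) (x n)) step) (x (Suc n))"
proof -
  interpret prob_space M by (rule chain_facts)
  have "measure M {\<omega> \<in> space M. \<forall>k\<le>m. Z k \<omega> = x k} =
      of_bool (x 0 = []) * (\<Prod>k<m. free_trans G I \<alpha> \<mu> (x k) (x (Suc k)))" if "m \<le> Suc n" for m
    using chain that assms by (auto simp: markov_chain_from_def)
  then have "measure M {\<omega> \<in> space M. \<forall>k\<le>Suc n. Z k \<omega> = x k} =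
      measure M {\<omega> \<in> space M. \<forall>k\<le>n. Z k \<omega> = x k} * free_trans G I \<alpha> \<mu> (x n) (x (Suc n))"
    by simp
  also have "free_trans G I \<alpha> \<mu> (x n) (x (Suc n)) = pmf (map_pmf ((\<star>) (x n)) step) (x (Suc n))"
    by (rule free_trans_eq_pmf) (use assms in auto)
  finally show ?thesis by (simp add: emeasure_eq_measure ennreal_mult)
qed

text \<open>
  The Markov property, extracted from the probabilities of finite paths: summing over the next
  state prolongs the path by one step and removes one set. The sum is countable because there are
  only countably many words.
\<close>
lemma chain_visits:
  assumes "\<And>k. k \<le> n \<Longrightarrow> x k \<in> W"
  shows "emeasure M {\<omega> \<in> space M. (\<forall>k\<le>n. Z k \<omega> = x k) \<and> (\<forall>j<length As. Z (Suc (n + j)) \<omega> \<in> As ! j)} =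
    emeasure M {\<omega> \<in> space M. \<forall>k\<le>n. Z k \<omega> = x k} * visits As (x n)"
  using assms
proof (induction As arbitrary: n x)
  case (Cons A As)
  let ?q = "map_pmf ((\<star>) (x n)) step"
  let ?P = "emeasure M {\<omega> \<in> space M. \<forall>k\<le>n. Z k \<omega> = x k}"
  define E where "E = (\<lambda>y. {\<omega> \<in> space M. (\<forall>k\<le>Suc n. Z k \<omega> = (x(Suc n := y)) k) \<and>
    (\<forall>j<length As. Z (Suc (Suc n + j)) \<omega> \<in> As ! j)})"
  have EE: "emeasure M (E y) = ?P * (ennreal (pmf ?q y) * visits As y)" if y: "y \<in> W" for y
  proof -
    have xW: "(x(Suc n := y)) k \<in> W" if "k \<le> Suc n" for k
      using that Cons.prems y by (auto simp: le_Suc_eq)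
    have "emeasure M (E y) = emeasure M {\<omega> \<in> space M. \<forall>k\<le>Suc n. Z k \<omega> = (x(Suc n := y)) k} * visits As y"
      unfolding E_def using Cons.IH[of "Suc n" "x(Suc n := y)", OF xW] by simp
    also have "emeasure M {\<omega> \<in> space M. \<forall>k\<le>Suc n. Z k \<omega> = (x(Suc n := y)) k} = ?P * ennreal (pmf ?q y)"
    proof -
      have "{\<omega> \<in> space M. \<forall>k\<le>n. Z k \<omega> = (x(Suc n := y)) k} = {\<omega> \<in> space M. \<forall>k\<le>n. Z k \<omega> = x k}"
        by auto
      then show ?thesis using chain_path_Suc[of n "x(Suc n := y)", OF xW] by simp
    qed
    finally show ?thesis by (simp add: mult.assoc)
  qed
  have "{\<omega> \<in> space M. (\<forall>k\<le>n. Z k \<omega> = x k) \<and> (\<forall>j<length (A # As). Z (Suc (n + j)) \<omega> \<in> (A # As) ! j)} =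
      (\<Union>y\<in>W \<inter> A. E y)"
  proof (intro Set.set_eqI iffI)
    fix \<omega>
    assume a: "\<omega> \<in> {\<omega> \<in> space M. (\<forall>k\<le>n. Z k \<omega> = x k) \<and> (\<forall>j<length (A # As). Z (Suc (n + j)) \<omega> \<in> (A # As) ! j)}"
    have 1: "Z (Suc n) \<omega> \<in> W" using measurable_space[OF chain_facts(2)] a by auto
    have 2: "Z (Suc n) \<omega> \<in> A" using a by force
    have "Z (Suc (Suc n + j)) \<omega> \<in> As ! j" if "j < length As" for j
      using a that by (auto dest!: spec[of _ "Suc j"])
    then have "\<omega> \<in> E (Z (Suc n) \<omega>)" using a by (auto simp: E_def le_Suc_eq)
    then show "\<omega> \<in> (\<Union>y\<in>W \<inter> A. E y)" using 1 2 by blast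
  next
    fix \<omega> assume "\<omega> \<in> (\<Union>y\<in>W \<inter> A. E y)"
    then obtain y where y: "y \<in> A" "\<omega> \<in> E y" by blast
    then have Z: "Z (Suc n) \<omega> = y" by (auto simp: E_def)
    have "Z (Suc (n + j)) \<omega> \<in> (A # As) ! j" if "j < length (A # As)" for j
      using that y Z by (cases j) (auto simp: E_def)
    moreover have "Z k \<omega> = x k" if "k \<le> n" for k
      using y(2) that by (auto simp: E_def dest!: spec[of _ k])
    ultimately show "\<omega> \<in> {\<omega> \<in> space M. (\<forall>k\<le>n. Z k \<omega> = x k) \<and> (\<forall>j<length (A # As). Z (Suc (n + j)) \<omega> \<in> (A # As) ! j)}"
      using y(2) by (auto simp: E_def)
  qed
  also have "emeasure M \<dots> = (\<integral>\<^sup>+y. emeasure M (E y) \<partial>count_space (W \<inter> A))"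
  proof (rule emeasure_UN_countable)
    show "E y \<in> sets M" for y unfolding E_def by measurable
    show "countable (W \<inter> A)" using countable_W by blast
    show "disjoint_family_on E (W \<inter> A)"
      unfolding disjoint_family_on_def E_def by force
  qed
  also have "\<dots> = (\<integral>\<^sup>+y. ?P * (ennreal (pmf ?q y) * visits As y) \<partial>count_space (W \<inter> A))"
    by (rule nn_integral_cong) (simp add: EE)
  also have "\<dots> = ?P * (\<integral>\<^sup>+y. ennreal (pmf ?q y) * visits As y \<partial>count_space (W \<inter> A))"
    by (rule nn_integral_cmult) simp
  also have "(\<integral>\<^sup>+y. ennreal (pmf ?q y) * visits As y \<partial>count_space (W \<inter> A)) =
      (\<integral>\<^sup>+y. ennreal (pmf ?q y) * (indicator A y * visits As y) \<partial>count_space UNIV)"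
  proof -
    have "pmf ?q y = 0" if "y \<notin> W" for y
      using that Cons.prems[of n] step_W by (auto simp: pmf_eq_0_set_pmf)
    then show ?thesis
      by (subst nn_integral_count_space_indicator)
         (auto intro!: nn_integral_cong simp: indicator_def)
  qed
  also have "\<dots> = (\<integral>\<^sup>+y. indicator A y * visits As y \<partial>?q)"
    by (rule nn_integral_measure_pmf[symmetric])
  also have "\<dots> = visits (A # As) (x n)" by simp
  finally show ?case .
qed simp

lemma chain_visits_start:
  "emeasure M {\<omega> \<in> space M. \<forall>j<length As. Z (Suc j) \<omega> \<in> As ! j} = visits As []"
proof -
  interpret prob_space M by (rule chain_facts)
  have "measure M {\<omega> \<in> space M. \<forall>k\<le>0. Z k \<omega> = (\<lambda>_. []) k} = 1"
    using chain unfolding markov_chain_from_def by (elim conjE allE[of _ 0] allE[of _ "\<lambda>_. []"]) auto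
  then have 0: "measure M {\<omega> \<in> space M. Z 0 \<omega> = []} = 1" by simp
  then have "AE \<omega> in M. Z 0 \<omega> = []" by (subst (asm) prob_Collect_eq_1) auto
  then have "emeasure M {\<omega> \<in> space M. \<forall>j<length As. Z (Suc j) \<omega> \<in> As ! j} =
      emeasure M {\<omega> \<in> space M. (\<forall>k\<le>0. Z k \<omega> = []) \<and> (\<forall>j<length As. Z (Suc (0 + j)) \<omega> \<in> As ! j)}"
    by (intro emeasure_eq_AE) auto
  also have "\<dots> = visits As []"
    using chain_visits[of 0 "\<lambda>_. []" As] 0 by (simp add: emeasure_eq_measure)
  finally show ?thesis .
qed

lemma chain_law: "measure M {\<omega> \<in> space M. Z n \<omega> \<in> A} = measure_pmf.prob (walk n []) A"
proof -
  interpret prob_space M by (rule chain_facts)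
  show ?thesis
  proof (cases n)
    case 0
    have "measure M {\<omega> \<in> space M. \<forall>k\<le>0. Z k \<omega> = (\<lambda>_. []) k} = 1"
      using chain unfolding markov_chain_from_def by (elim conjE allE[of _ 0] allE[of _ "\<lambda>_. []"]) auto
    then have "AE \<omega> in M. Z 0 \<omega> = []" by (simp add: prob_Collect_eq_1)
    then have "measure M {\<omega> \<in> space M. Z 0 \<omega> \<in> A} = measure M {\<omega> \<in> space M. [] \<in> A}"
      by (intro finite_measure_eq_AE) auto
    then show ?thesis using 0 by (auto simp: prob_space indicator_def)
  next
    case (Suc m)
    have "{\<omega> \<in> space M. Z n \<omega> \<in> A} =
        {\<omega> \<in> space M. \<forall>j<length (replicate m UNIV @ [A]). Z (Suc j) \<omega> \<in> (replicate m UNIV @ [A]) ! j}"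
      by (auto simp: Suc nth_append less_Suc_eq)
    then have "emeasure M {\<omega> \<in> space M. Z n \<omega> \<in> A} = emeasure (walk n []) A"
      using chain_visits_start[of "replicate m UNIV @ [A]"] visits_last[of m A "[]"] Suc by simp
    then show ?thesis by (simp add: measure_def)
  qed
qed

lemma chain_excursion:
  assumes i: "i \<in> I"
  shows "measure M {\<omega> \<in> space M. return_time Z [] \<omega> = enat (Suc (Suc m)) \<and>
    Z 1 \<omega> \<notin> embed G i ` carrier (G i)} = ret i (Suc m)"
proof -
  let ?R = "embed G i ` carrier (G i)"
  \<comment> \<open>The sets for the times from 1 to \<open>m + 2\<close>; the first one excludes the empty word as well.\<close>
  let ?As = "(- ?R) # replicate m (- {[]}) @ [{[]}]"
  interpret Gi: group "G i" by (rule grp[OF i])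
  have Nil: "[] \<in> ?R" by (auto simp: embed_def image_iff intro!: bexI[of _ "\<one>\<^bsub>G i\<^esub>"])
  have "(return_time Z [] \<omega> = enat (Suc (Suc m)) \<and> Z 1 \<omega> \<notin> ?R) \<longleftrightarrow>
      (\<forall>j<length ?As. Z (Suc j) \<omega> \<in> ?As ! j)" for \<omega>
  proof -
    have "(\<forall>j<length ?As. Z (Suc j) \<omega> \<in> ?As ! j) \<longleftrightarrow>
        Z 1 \<omega> \<notin> ?R \<and> (\<forall>j<m. Z (Suc (Suc j)) \<omega> \<noteq> []) \<and> Z (Suc (Suc m)) \<omega> = []"
    proof -
      have "(\<forall>j<length ?As. Z (Suc j) \<omega> \<in> ?As ! j) \<longleftrightarrow>
          Z 1 \<omega> \<notin> ?R \<and> (\<forall>j<Suc m. Z (Suc (Suc j)) \<omega> \<in> (replicate m (- {[]}) @ [{[]}]) ! j)"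
        by (simp add: All_less_Suc2)
      also have "\<dots> \<longleftrightarrow> Z 1 \<omega> \<notin> ?R \<and> (\<forall>j<m. Z (Suc (Suc j)) \<omega> \<noteq> []) \<and> Z (Suc (Suc m)) \<omega> = []"
        by (auto simp: All_less_Suc nth_append)
      finally show ?thesis .
    qed
    also have "\<dots> \<longleftrightarrow> Z 1 \<omega> \<notin> ?R \<and> (\<forall>k. 0 < k \<and> k < Suc (Suc m) \<longrightarrow> Z k \<omega> \<noteq> []) \<and> Z (Suc (Suc m)) \<omega> = []"
    proof (intro conj_cong refl iffI allI impI)
      fix k assume a: "Z 1 \<omega> \<notin> ?R" "\<forall>j<m. Z (Suc (Suc j)) \<omega> \<noteq> []" "0 < k \<and> k < Suc (Suc m)"
      then obtain l where k: "k = Suc l" "l < Suc m" by (cases k) auto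
      show "Z k \<omega> \<noteq> []" using a k Nil by (cases l) auto
    qed auto
    finally show ?thesis by (auto simp: return_time_eq)
  qed
  then have "emeasure M {\<omega> \<in> space M. return_time Z [] \<omega> = enat (Suc (Suc m)) \<and> Z 1 \<omega> \<notin> ?R} =
      ennreal (ret i (Suc m))"
    using chain_visits_start[of ?As] visits_excursion[OF i, of m] by simp
  then show ?thesis by (simp add: measure_def ret_nonneg)
qed

lemma Hbar_eq:
  assumes i: "i \<in> I"
  shows "Hbar M Z G i 1 = ret_gf i 1"
proof -
  let ?f = "\<lambda>n. measure M {\<omega> \<in> space M. return_time Z [] \<omega> = enat n \<and> Z 1 \<omega> \<notin> embed G i ` carrier (G i)}"
  have bij: "bij_betw (\<lambda>m. Suc (Suc m)) UNIV {2..}"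
    by (rule bij_betwI[where g = "\<lambda>n. n - 2"]) auto
  have "Hbar M Z G i 1 = infsum ?f {2..}"
    unfolding Hbar_def by (simp only: power_one mult_1_right)
  also have "\<dots> = (\<Sum>\<^sub>\<infinity>m. ?f (Suc (Suc m)))"
    by (rule infsum_reindex_bij_betw[OF bij, symmetric])
  also have "\<dots> = (\<Sum>\<^sub>\<infinity>m. ret i (Suc m))" by (simp only: chain_excursion[OF i])
  also have "\<dots> = (\<Sum>m. ret i (Suc m))"
  proof (rule infsumI, rule norm_summable_imp_has_sum)
    have s: "summable (\<lambda>m. ret i (Suc m))" using summable_ret[OF i] by (simp add: summable_Suc_iff)
    then show "summable (\<lambda>m. norm (ret i (Suc m)))" by (simp add: ret_nonneg)
    show "(\<lambda>m. ret i (Suc m)) sums (\<Sum>m. ret i (Suc m))" using s by (rule summable_sums)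
  qed
  also have "\<dots> = ret_gf i 1"
    using suminf_split_head[OF summable_ret[OF i]] by (simp add: ret_gf_def ret_0)
  finally show ?thesis .
qed

lemma xi_link: "i \<in> I \<Longrightarrow> xi M Z G \<alpha> i 1 = \<xi> i 1"
  by (simp add: xi_def \<xi>_def Hbar_eq)

lemma chain_speed:
  "AE \<omega> in M. (\<lambda>n. real (length (Z n \<omega>)) / real n) \<longlonglongrightarrow>
    (\<Sum>i\<in>I. let \<xi> = xi M Z G \<alpha> i 1 in \<alpha> i * ((1 - \<xi>) / \<xi>) *
       (1 - (1 - \<xi>) * green (carrier (G i)) (group_trans (G i) (\<mu> i)) \<one>\<^bsub>G i\<^esub> \<one>\<^bsub>G i\<^esub> \<xi>))"
proof -
  have "(\<Sum>i\<in>I. let \<xi> = xi M Z G \<alpha> i 1 in \<alpha> i * ((1 - \<xi>) / \<xi>) *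
       (1 - (1 - \<xi>) * green (carrier (G i)) (group_trans (G i) (\<mu> i)) \<one>\<^bsub>G i\<^esub> \<one>\<^bsub>G i\<^esub> \<xi>)) = speed"
    unfolding speed_def by (intro sum.cong refl) (simp add: xi_link rate_term_def Let_def)
  then show ?thesis using AE_speed[OF chain_facts chain_law] by simp
qed

end

end


theorem mainTheorem4:
  fixes G :: "nat \<Rightarrow> ('a, 'b) monoid_scheme"
    and r :: nat
    and \<alpha> :: "nat \<Rightarrow> real"
    and \<mu> :: "nat \<Rightarrow> 'a pmf"
    and M :: "'w measure"
    and Z :: "nat \<Rightarrow> 'w \<Rightarrow> (nat \<times> 'a) list"
  assumes "r \<ge> 2"
    and "\<And>i. i \<in> {1..r} \<Longrightarrow> group (G i)"
    and "\<And>i. i \<in> {1..r} \<Longrightarrow> carrier (G i) \<noteq> {\<one>\<^bsub>G i\<^esub>}"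
    and "\<And>i. i \<in> {1..r} \<Longrightarrow>
           \<exists>S. finite S \<and> S \<subseteq> carrier (G i) \<and> generate (G i) S = carrier (G i)"
    and "\<not> (r = 2 \<and> card (carrier (G 1)) = 2 \<and> card (carrier (G 2)) = 2)"
    and "\<And>i. i \<in> {1..r} \<Longrightarrow> set_pmf (\<mu> i) \<subseteq> carrier (G i) - {\<one>\<^bsub>G i\<^esub>}"
    and "\<And>i. i \<in> {1..r} \<Longrightarrow> irreducible_chain (carrier (G i)) (group_trans (G i) (\<mu> i))"
    and "\<And>i. i \<in> {1..r} \<Longrightarrow> \<alpha> i > 0"
    and "(\<Sum>i\<in>{1..r}. \<alpha> i) = 1"
    and "markov_chain_from M (carrier (free_product G {1..r}))
           (free_trans G {1..r} \<alpha> \<mu>) \<one>\<^bsub>free_product G {1..r}\<^esub> Z"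
  shows "AE \<omega> in M.
    (\<lambda>n. real (block_length (Z n \<omega>)) / real n) \<longlonglongrightarrow>
      (\<Sum>i\<in>{1..r}.
         let \<xi> = xi M Z G \<alpha> i 1 in
         \<alpha> i * ((1 - \<xi>) / \<xi>) *
           (1 - (1 - \<xi>) * green (carrier (G i)) (group_trans (G i) (\<mu> i)) \<one>\<^bsub>G i\<^esub> \<one>\<^bsub>G i\<^esub> \<xi>))"
proof -
  interpret free_product_walk G "{1..r}" \<alpha> \<mu>
    by (rule free_product_walk.intro[OF finite_atLeastAtMost assms(2,6,8,9)])
  have "countable (carrier (G i))" if i: "i \<in> {1..r}" for i
  proof -
    obtain S where "finite S" "generate (G i) S = carrier (G i)" using assms(4)[OF i] by blast
    then show ?thesis using countable_generate[OF countable_finite, of S "G i"] by simp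
  qed
  then have "countable (blocks G {1..r})" unfolding blocks_def by (intro countable_SIGMA) auto
  moreover have "carrier (free_product G {1..r}) \<subseteq> lists (blocks G {1..r})"
    unfolding free_product_simps(1) by blast
  ultimately have "countable (carrier (free_product G {1..r}))"
    by (metis countable_lists countable_subset)
  then show ?thesis using assms(10) by (intro chain_speed) (simp_all add: free_product_simps(3))
qed

end
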